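(* For every $d\in\mathbb{N}$ there exists $\mathsf{C}_d\in(0,\infty)$ such that for all integers $n\ge k\ge d$, every function $f:\{-1,1\}^n\to\mathbb{R}$ of degree at most $d$ satisfies $$\inf_{g\in \mathscr{P}_{>k}^n} \|f-g\|_1 \leq \mathsf{K} \big( \widehat{f}, \mathsf{C}_d k^d; \ell_2^m, \ell_{\frac{2d}{d-1}}^m\big),$$ where $\widehat f=(\widehat f(S))_{|S|\le d}$ is the vector of Fourier coefficients of $f$, viewed as an element of $\mathbb{R}^m$ with $m=\binom n0+\cdots+\binom nd$, and $\ell_{\frac{2d}{d-1}}^m$ is interpreted as $\ell_\infty^m$ when $d=1$.
   Context: Every $f:\{-1,1\}^n\to\mathbb{R}$ has a unique Fourier–Walsh expansion $f=\sum_{S\subseteq\{1,\dots,n\}}\widehat f(S)w_S$, where $w_S(x)=\prod_{i\in S}x_i$; $f$ has degree at most $d$ if $\widehat f(S)=0$ whenever $|S|>d$. $\mathscr{P}^n_{>k}=\{g:\{-1,1\}^n\to\mathbb{R}:\ \widehat g(S)=0 \text{ whenever } |S|\le k\}$. $\|\cdot\|_1$ is the $L_1$ norm with respect to the uniform probability measure on $\{-1,1\}^n$. For normed spaces $A_0,A_1$ on $\mathbb{R}^m$, $t\ge0$ and $a\in\mathbb{R}^m$, the $\mathsf{K}$-functional is $\mathsf{K}(a,t;A_0,A_1)=\inf\{\|a_0\|_{A_0}+t\|a_1\|_{A_1}:\ a=a_0+a_1\}$. *)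

theory Defs
  imports Complex_Main
begin

text \<open>The discrete cube \{-1,1\}^n, represented by functions nat \<Rightarrow> real that take
  values in \{-1,1\} on coordinates 0..n-1 and are 1 (a dummy value) elsewhere.\<close>
definition cube :: "nat \<Rightarrow> (nat \<Rightarrow> real) set" where
  "cube n = {x. (\<forall>i<n. x i = -1 \<or> x i = 1) \<and> (\<forall>i\<ge>n. x i = 1)}"

definition walsh :: "nat set \<Rightarrow> (nat \<Rightarrow> real) \<Rightarrow> real" where
  "walsh S x = (\<Prod>i\<in>S. x i)"

definition fourier :: "nat \<Rightarrow> ((nat \<Rightarrow> real) \<Rightarrow> real) \<Rightarrow> nat set \<Rightarrow> real" where
  "fourier n f S = (\<Sum>x\<in>cube n. f x * walsh S x) / 2 ^ n"

definition degree_le :: "nat \<Rightarrow> nat \<Rightarrow> ((nat \<Rightarrow> real) \<Rightarrow> real) \<Rightarrow> bool" where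
  "degree_le n d f \<longleftrightarrow> (\<forall>S. S \<subseteq> {..<n} \<and> card S > d \<longrightarrow> fourier n f S = 0)"

definition P_gt :: "nat \<Rightarrow> nat \<Rightarrow> ((nat \<Rightarrow> real) \<Rightarrow> real) set" where
  "P_gt n k = {g. \<forall>S. S \<subseteq> {..<n} \<and> card S \<le> k \<longrightarrow> fourier n g S = 0}"

definition L1_norm :: "nat \<Rightarrow> ((nat \<Rightarrow> real) \<Rightarrow> real) \<Rightarrow> real" where
  "L1_norm n f = (\<Sum>x\<in>cube n. \<bar>f x\<bar>) / 2 ^ n"

text \<open>Index set of R^m: subsets S of \{0..n-1\} with |S| <= d.\<close>
definition low_sets :: "nat \<Rightarrow> nat \<Rightarrow> nat set set" where
  "low_sets n d = {S. S \<subseteq> {..<n} \<and> card S \<le> d}"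

definition lp_norm :: "'i set \<Rightarrow> real \<Rightarrow> ('i \<Rightarrow> real) \<Rightarrow> real" where
  "lp_norm I p a = (\<Sum>i\<in>I. \<bar>a i\<bar> powr p) powr (1 / p)"

definition linf_norm :: "'i set \<Rightarrow> ('i \<Rightarrow> real) \<Rightarrow> real" where
  "linf_norm I a = Max ((\<lambda>i. \<bar>a i\<bar>) ` I)"

definition ell_d_norm :: "nat \<Rightarrow> 'i set \<Rightarrow> ('i \<Rightarrow> real) \<Rightarrow> real" where
  "ell_d_norm d I a = (if d = 1 then linf_norm I a
                       else lp_norm I (2 * real d / (real d - 1)) a)"

text \<open>K-functional K(a, t; A0, A1) for norms N0, N1 (only depending on the coordinates in
  the index set): infimum of N0 a0 + t N1 a1 over all decompositions a = a0 + a1.\<close>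
definition K_functional ::
  "(('i \<Rightarrow> real) \<Rightarrow> real) \<Rightarrow> (('i \<Rightarrow> real) \<Rightarrow> real) \<Rightarrow> ('i \<Rightarrow> real) \<Rightarrow> real \<Rightarrow> real" where
  "K_functional N0 N1 a t = (INF a0 \<in> UNIV. N0 a0 + t * N1 (\<lambda>i. a i - a0 i))"

end

theory Submission
  imports Defs "HOL-Analysis.Convex" "HOL-Computational_Algebra.Polynomial"
begin

text \<open>
  By Hahn--Banach, the \<open>L\<^sub>1\<close>-distance of \<open>f\<close> to the functions of degree above \<open>k\<close> is the
  pairing of \<open>f\<close> with some \<open>h\<close> of degree at most \<open>k\<close> with \<open>|h| \<le> 1\<close>. The part of the pairing
  coming from the \<open>\<ell>\<^sub>2\<close> summand is handled by Cauchy--Schwarz and Parseval, the other one by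
  Hoelder, provided that the Fourier coefficients of \<open>h\<close> up to level \<open>d\<close> have \<open>\<ell>\<^sub>p\<close>-norm
  \<open>O(k^d)\<close> for \<open>p = 2d/(d+1)\<close>.

  V. Markov's coefficient inequality, applied to \<open>t \<mapsto> h(tx)\<close>, bounds the low-degree part \<open>g\<close> of
  \<open>h\<close> by \<open>O(k^d)\<close>. The same inequality, applied to \<open>t \<mapsto> g(x/2 + ty/2)\<close>, bounds
  \<open>\<Sum>i. |\<partial>\<^sub>i g(x/2)|\<close>. Averaging over \<open>x\<close> and comparing \<open>L\<^sub>1\<close> with \<open>L\<^sub>2\<close> by Bonami's inequality
  bounds \<open>\<Sum>i. M\<^sub>i\<close>, where \<open>M\<^sub>i\<^sup>2\<close> is the sum of the squared coefficients of the sets containing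
  \<open>i\<close>. After normalisation, each coefficient \<open>c\<close> of a set \<open>S\<close> satisfies
  \<open>c^p \<le> (\<Sum>i\<in>S. c\<^sup>2 / M\<^sub>i) + (\<Prod>i\<in>S. M\<^sub>i)\<close>, and the right-hand side is summable over \<open>S\<close>.
\<close>

subsection \<open>Coefficients of bounded polynomials\<close>

fun chebyshev :: "nat \<Rightarrow> real poly" where
  "chebyshev 0 = 1"
| "chebyshev (Suc 0) = [:0, 1:]"
| "chebyshev (Suc (Suc n)) = [:0, 2:] * chebyshev (Suc n) - chebyshev n"

lemma poly_chebyshev_cos: "poly (chebyshev n) (cos t) = cos (real n * t)"
proof (induction n rule: chebyshev.induct)
  case (3 n)
  have "cos (real (Suc (Suc n)) * t) + cos (real n * t) = 2 * cos t * cos (real (Suc n) * t)"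
    using cos_plus_cos[of "real (Suc (Suc n)) * t" "real n * t"]
    by (simp add: algebra_simps add_divide_distrib)
  with 3 show ?case by simp
qed auto

lemma poly_chebyshev_uminus: "poly (chebyshev n) (- x) = (- 1) ^ n * poly (chebyshev n) x"
  by (induction n rule: chebyshev.induct) (auto simp: algebra_simps)

lemma degree_chebyshev_le: "degree (chebyshev n) \<le> n"
proof (induction n rule: chebyshev.induct)
  case (3 n)
  have "degree ([:0, 2:] * chebyshev (Suc n)) \<le> Suc (Suc n)"
    using 3 degree_mult_le[of "[:0, 2:]" "chebyshev (Suc n)"] by simp
  with 3 show ?case by (auto intro!: degree_diff_le)
qed auto

text \<open>Induction along the recurrence: the bounds \<open>2 * (n + 2) ^ i\<close> and
  \<open>n * (n + 2) ^ i\<close> for its two terms add up to exactly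
  \<open>(n + 2) ^ (i + 1)\<close>.\<close>

lemma coeff_chebyshev_le: "\<bar>coeff (chebyshev n) j\<bar> \<le> real n ^ j"
proof (induction n arbitrary: j rule: chebyshev.induct)
  case 1
  show ?case by (cases j) auto
next
  case 2
  show ?case by (auto simp: coeff_pCons split: nat.split)
next
  case (3 n)
  show ?case
  proof (cases j)
    case 0
    with 3(2)[of 0] show ?thesis by simp
  next
    case (Suc i)
    have "\<bar>coeff (chebyshev (Suc (Suc n))) j\<bar> \<le> 2 * \<bar>coeff (chebyshev (Suc n)) i\<bar> + \<bar>coeff (chebyshev n) j\<bar>"
      using Suc by simp
    also have "\<dots> \<le> 2 * real (Suc n) ^ i + real n * real n ^ i"
      using 3(1)[of i] 3(2)[of j] Suc by simp
    also have "\<dots> \<le> 2 * real (Suc (Suc n)) ^ i + real n * real (Suc (Suc n)) ^ i"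
      by (intro add_mono mult_left_mono power_mono) auto
    also have "\<dots> = real (Suc (Suc n)) ^ j"
      using Suc by (simp add: algebra_simps)
    finally show ?thesis .
  qed
qed

section \<open>Zeros and coefficients of real polynomials\<close>

lemma strict_roots_pderiv:
  fixes p :: "real poly"
  assumes "\<And>i. i \<le> m \<Longrightarrow> poly p (r i) = 0" "\<And>i. i < m \<Longrightarrow> r i < r (Suc i)"
  obtains s where "\<And>i. i < m \<Longrightarrow> poly (pderiv p) (s i) = 0"
    "\<And>i. Suc i < m \<Longrightarrow> s i < s (Suc i)"
proof -
  have "\<exists>x. r i < x \<and> x < r (Suc i) \<and> poly (pderiv p) x = 0" if "i < m" for i
    using poly_MVT[OF assms(2)[OF that], of p] assms that by auto
  then obtain s where s: "\<And>i. i < m \<Longrightarrow> r i < s i \<and> s i < r (Suc i) \<and> poly (pderiv p) (s i) = 0"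
    by metis
  show thesis
    by (rule that[of s]) (use s in blast, meson less_trans Suc_lessD s)
qed

lemma strict_mono_below:
  fixes r :: "nat \<Rightarrow> real"
  assumes "\<And>i. Suc i < m \<Longrightarrow> r i < r (Suc i)" "i < j" "j < m"
  shows "r i < r j"
  using assms(2,3)
proof (induction j)
  case (Suc j)
  then show ?case using assms(1)[of j] by (cases "i = j") auto
qed auto

text \<open>Rolle's theorem reduces this to \<open>j = 0\<close>, where \<open>0\<close> would be a double root.\<close>
lemma distinct_real_roots_no_consecutive_zero_coeffs:
  fixes p :: "real poly"
  assumes "p \<noteq> 0" "degree p = m" "\<And>i. i < m \<Longrightarrow> poly p (r i) = 0"
    "\<And>i. Suc i < m \<Longrightarrow> r i < r (Suc i)" "coeff p j = 0" "coeff p (Suc j) = 0" "j \<le> m"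
  shows False
  using assms
proof (induction j arbitrary: p r m)
  case 0
  have inj: "inj_on r {..<m}"
    by (rule inj_onI) (metis "0.prems"(4) lessThan_iff linorder_neqE_nat order_less_irrefl strict_mono_below)
  have fin: "finite {x. poly p x = 0}" using 0(1) by (rule poly_roots_finite)
  have sub: "r ` {..<m} \<subseteq> {x. poly p x = 0}" using 0(3) by auto
  have "[:0, 1:] ^ 2 dvd p"
  proof -
    obtain a q where q: "p = pCons a q" by (cases p)
    obtain b q' where q': "q = pCons b q'" by (cases q)
    have "p = [:0, 1:] ^ 2 * q'" using 0(5,6) q q' by (simp add: power2_eq_square)
    then show ?thesis by simp
  qed
  then have ord: "order 0 p \<ge> 2" using 0(1) order_divides[of 0 2 p] by simp
  have root0: "poly p 0 = 0" using 0(5) by (simp add: poly_0_coeff_0)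
  have "card (r ` {..<m}) = m" using inj by (simp add: card_image)
  then have cm: "m \<le> card {x. poly p x = 0}" using card_mono[OF fin sub] by simp
  \<comment> \<open>Every root counts at least once and the root 0 at least twice, so the degree
    \<open>m\<close> would exceed the number of distinct roots.\<close>
  have "(\<Sum>x\<in>{x. poly p x = 0}. 1 + (if x = 0 then 1 else 0)) \<le> (\<Sum>x\<in>{x. poly p x = 0}. order x p)"
    using ord 0(1) by (intro sum_mono) (auto simp: order_root Suc_le_eq)
  also have "\<dots> \<le> m" using sum_order_le_degree[OF 0(1)] 0(2) by simp
  finally have "card {x. poly p x = 0} + 1 \<le> m" using fin root0 by (simp only: sum.distrib sum.delta) simp
  with cm show False by simp
next
  case (Suc j)
  show False
  proof (cases m)
    case 0
    with Suc.prems(7) show False by simp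
  next
    case (Suc m')
    have dp: "degree (pderiv p) = m'" using Suc Suc.prems(2) by (simp add: degree_pderiv)
    have nz: "pderiv p \<noteq> 0" using Suc Suc.prems(2) by (auto simp: pderiv_eq_0_iff)
    obtain s where "\<And>i. i < m' \<Longrightarrow> poly (pderiv p) (s i) = 0" "\<And>i. Suc i < m' \<Longrightarrow> s i < s (Suc i)"
      using strict_roots_pderiv[of m' p r] Suc Suc.prems by auto
    from Suc.IH[of "pderiv p" m' s, OF nz dp this] show False using Suc.prems(5,6,7) Suc by (simp add: coeff_pderiv)
  qed
qed

text \<open>Intermediate value theorem between consecutive nodes; the factor \<open>c\<close> fixes
  the sign with which the alternation starts.\<close>

lemma alternating_signs_roots:
  fixes q :: "real poly"
  assumes "\<And>i. i < m \<Longrightarrow> t i < t (Suc i)" "\<And>i. i \<le> m \<Longrightarrow> 0 < c * (- 1) ^ i * poly q (t i)"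
  obtains s where "\<And>i. i < m \<Longrightarrow> poly q (s i) = 0" "\<And>i. Suc i < m \<Longrightarrow> s i < s (Suc i)"
proof -
  have "\<exists>x. t i < x \<and> x < t (Suc i) \<and> poly q x = 0" if "i < m" for i
  proof -
    have "0 < (c * (- 1) ^ i * poly q (t i)) * (c * (- 1) ^ Suc i * poly q (t (Suc i)))"
      using that by (intro mult_pos_pos[OF assms(2) assms(2)]) auto
    also have "\<dots> = - ((c * (- 1) ^ i)\<^sup>2 * (poly q (t i) * poly q (t (Suc i))))"
      by (simp add: power2_eq_square)
    finally have "poly q (t i) * poly q (t (Suc i)) < 0"
      by (metis neg_0_less_iff_less not_less zero_le_mult_iff zero_le_power2)
    from poly_IVT[OF assms(1)[OF that] this] show ?thesis by blast
  qed
  then obtain s where s: "\<And>i. i < m \<Longrightarrow> t i < s i \<and> s i < t (Suc i) \<and> poly q (s i) = 0"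
    by metis
  show thesis
    by (rule that[of s]) (use s in blast, meson less_trans Suc_lessD s)
qed

text \<open>If the claim failed, a combination of \<open>p\<close> and the Chebyshev polynomial would have a
  vanishing \<open>j\<close>-th coefficient while still alternating at the \<open>m + 1\<close> Chebyshev nodes.\<close>
lemma coeff_le_of_bounded_parity:
  fixes p :: "real poly"
  assumes "degree p \<le> m" "\<And>x. \<bar>x\<bar> \<le> 1 \<Longrightarrow> \<bar>poly p x\<bar> \<le> 1" "j \<le> m"
    and even: "even (m + j)" and parity: "\<And>i. odd (m + i) \<Longrightarrow> coeff p i = 0"
  shows "\<bar>coeff p j\<bar> \<le> real m ^ j"
proof (rule ccontr)
  assume *: "\<not> ?thesis"
  have cp: "\<bar>coeff (chebyshev m) j\<bar> < \<bar>coeff p j\<bar>" using coeff_chebyshev_le[of m j] * by linarith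
  \<comment> \<open>Scaled so that coefficient \<open>j\<close> cancels in \<open>q\<close>. Since
    \<open>\<bar>l\<bar> < 1\<close>, subtracting \<open>l\<close> times \<open>p\<close> cannot
    change the sign of the Chebyshev polynomial at nodes where its modulus is 1.\<close>
  define l where "l = coeff (chebyshev m) j / coeff p j"
  have l: "\<bar>l\<bar> < 1" using cp by (simp add: l_def abs_divide divide_less_eq)
  define q where "q = chebyshev m - smult l p"
  \<comment> \<open>The extremal points of \<open>chebyshev m\<close> on [-1, 1]; counting down with
    \<open>m - i\<close> lists them in increasing order.\<close>
  define t where "t = (\<lambda>i. cos (real (m - i) * (pi / real m)))"
  have cq: "coeff q j = 0" using cp by (auto simp: q_def l_def)
  have "coeff (chebyshev m) i = 0" if "odd (m + i)" for i
  proof -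
    have "poly (pcompose (chebyshev m) [:0, -1:]) = poly (smult ((-1)^m) (chebyshev m))"
      by (rule ext) (simp add: poly_pcompose poly_chebyshev_uminus)
    then have "pcompose (chebyshev m) [:0, -1:] = smult ((-1)^m) (chebyshev m)"
      by (simp add: poly_eq_poly_eq_iff)
    then have "(-1) ^ i * coeff (chebyshev m) i = (-1) ^ m * coeff (chebyshev m) i"
      by (metis coeff_pcompose_linear coeff_smult)
    with that show ?thesis by (auto simp: minus_one_power_iff split: if_splits)
  qed
  \<comment> \<open>The index \<open>Suc j\<close> has the wrong parity for both polynomials, so two
    consecutive coefficients of \<open>q\<close> vanish.\<close>
  then have cq': "coeff q (Suc j) = 0" using even parity by (simp add: q_def)
  have ti: "t i < t (Suc i)" if "i < m" for i
  proof -
    have "pi * (1 + real i) \<le> pi * real m" "pi * real i \<le> pi * real m"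
      using that by (auto intro: mult_left_mono)
    then show ?thesis
      unfolding t_def using that by (intro cos_monotone_0_pi) (auto simp: field_simps)
  qed
  have si: "0 < (-1) ^ m * (- 1) ^ i * poly q (t i)" if "i \<le> m" for i
  proof (cases "m = 0")
    case True
    have "\<bar>poly p (t i)\<bar> \<le> 1" using assms(2) by (simp add: t_def)
    then have "\<bar>l * poly p (t i)\<bar> < 1" using l
      by (metis abs_ge_zero abs_mult dual_order.strict_trans2 mult_left_le)
    then show ?thesis using True that by (simp add: q_def)
  next
    case False
    have "poly (chebyshev m) (t i) = (-1) ^ (m - i)"
      using False by (simp add: t_def poly_chebyshev_cos)
    also have "\<dots> = (-1) ^ m * (- 1) ^ i" using that by (auto simp: minus_one_power_iff)
    finally have ch: "poly (chebyshev m) (t i) = (-1) ^ m * (- 1) ^ i" .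
    have "\<bar>poly p (t i)\<bar> \<le> 1" using assms(2) by (simp add: t_def)
    then have "\<bar>l * poly p (t i)\<bar> < 1" using l
      by (metis abs_ge_zero abs_mult dual_order.strict_trans2 mult_left_le)
    then show ?thesis using ch by (auto simp: q_def minus_one_power_iff)
  qed
  obtain s where s: "\<And>i. i < m \<Longrightarrow> poly q (s i) = 0" "\<And>i. Suc i < m \<Longrightarrow> s i < s (Suc i)"
    using alternating_signs_roots[of m t "(-1) ^ m" q, OF ti si] by blast
  have q0: "q \<noteq> 0" using si[of 0] by auto
  have dq: "degree q \<le> m" unfolding q_def
    using degree_chebyshev_le[of m] assms(1) by (auto intro!: degree_diff_le order_trans[OF degree_smult_le])
  have "inj_on s {..<m}"
    by (rule inj_onI) (metis s(2) lessThan_iff linorder_neqE_nat order_less_irrefl strict_mono_below)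
  then have "m \<le> card {x. poly q x = 0}"
    using card_mono[OF poly_roots_finite[OF q0], of "s ` {..<m}"] s(1) by (auto simp: card_image)
  then have "degree q = m" using card_poly_roots_bound[OF q0] dq by simp
  from distinct_real_roots_no_consecutive_zero_coeffs[of q m s j, OF q0 this s cq cq' assms(3)] show False .
qed

text \<open>V. Markov's inequality in a coarse form. The even or odd part of \<open>p\<close>,
  whichever has the parity of \<open>j\<close>, inherits both the bound and the coefficient, which
  reduces to the previous lemma; \<open>B\<close> is removed by scaling.\<close>

lemma coeff_le_of_bounded:
  fixes p :: "real poly"
  assumes "degree p \<le> k" "\<And>x. \<bar>x\<bar> \<le> 1 \<Longrightarrow> \<bar>poly p x\<bar> \<le> B"
  shows "\<bar>coeff p j\<bar> \<le> B * real k ^ j"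
proof -
  have B0: "0 \<le> B" using assms(2)[of 0] by simp
  have main: "\<bar>coeff p j\<bar> \<le> real k ^ j"
    if deg: "degree p \<le> k" and bd: "\<And>x. \<bar>x\<bar> \<le> 1 \<Longrightarrow> \<bar>poly p x\<bar> \<le> 1" for p :: "real poly"
  proof (cases "j \<le> k")
    case False
    with deg show ?thesis by (simp add: coeff_eq_0)
  next
    case True
    \<comment> \<open>The largest number up to \<open>k\<close> with the parity of
      \<open>j\<close>.\<close>
    define m where "m = (if even (k + j) then k else k - 1)"
    have m: "j \<le> m" "m \<le> k" "even (m + j)" "k \<le> Suc m"
      using True by (auto simp: m_def) (metis Suc_pred dvd_refl even_add le_Suc_eq neq0_conv not_less_eq_eq zero_le)+
    define e where "e = smult (1/2) (p + smult ((-1) ^ j) (pcompose p [:0, -1:]))"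
    have ce: "coeff e i = (if even (i + j) then coeff p i else 0)" for i
      by (auto simp: e_def coeff_pcompose_linear minus_one_power_iff)
    have "degree e \<le> m"
    proof (rule degree_le, intro allI impI)
      fix i assume "m < i"
      show "coeff e i = 0"
      proof (cases "i > k")
        case True
        then show ?thesis using deg ce by (simp add: coeff_eq_0)
      next
        case False
        then have "i = Suc m" using m \<open>m < i\<close> by simp
        then show ?thesis using ce m(3) by simp
      qed
    qed
    moreover have "\<bar>poly e x\<bar> \<le> 1" if "\<bar>x\<bar> \<le> 1" for x
      using bd[of x] bd[of "-x"] that
      by (auto simp: e_def poly_pcompose minus_one_power_iff)
    ultimately have "\<bar>coeff e j\<bar> \<le> real m ^ j"
      using m ce by (intro coeff_le_of_bounded_parity) auto
    also have "\<dots> \<le> real k ^ j" using m by (intro power_mono) auto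
    finally show ?thesis using ce[of j] by simp
  qed
  show ?thesis
  proof (cases "B = 0")
    case False
    have "\<bar>coeff (smult (1 / B) p) j\<bar> \<le> real k ^ j"
      using assms B0 False by (intro main) (auto simp: abs_mult divide_le_eq)
    then show ?thesis using B0 False by (simp add: abs_mult field_simps)
  next
    case True
    \<comment> \<open>The bound 0 survives every scaling, so the estimate for all \<open>N\<close>
      forces the coefficient to vanish.\<close>
    have "\<bar>coeff (smult N p) j\<bar> \<le> real k ^ j" for N
      using assms True by (intro main) (auto intro: order_trans[OF degree_smult_le])
    from this[of "(real k ^ j + 1) / coeff p j"] have "coeff p j = 0"
      by (cases "coeff p j = 0") auto
    then show ?thesis using True by simp
  qed
qed

subsection \<open>Fourier analysis on the cube\<close>

definition cube_avg :: "nat \<Rightarrow> ((nat \<Rightarrow> real) \<Rightarrow> real) \<Rightarrow> real" where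
  "cube_avg n f = (\<Sum>x\<in>cube n. f x) / 2 ^ n"

text \<open>Meaningful at every real point, not only on the cube: this is the multilinear extension,
  which the polynomial arguments evaluate inside the box.\<close>

definition walsh_sum :: "nat \<Rightarrow> (nat set \<Rightarrow> real) \<Rightarrow> (nat \<Rightarrow> real) \<Rightarrow> real" where
  "walsh_sum n a x = (\<Sum>S\<in>Pow {..<n}. a S * walsh S x)"

lemma cube_0: "cube 0 = {\<lambda>_. 1}"
  by (auto simp: cube_def)

lemma cube_last: "x \<in> cube n \<Longrightarrow> x n = 1"
  by (simp add: cube_def)

text \<open>The dummy value 1 makes \<open>cube n\<close> itself the half of
  \<open>cube (Suc n)\<close> whose last coordinate is 1; flipping that coordinate gives the other
  half. The inductions on \<open>n\<close> rest on this splitting.\<close>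

lemma cube_Suc: "cube (Suc n) = cube n \<union> (\<lambda>x. x(n := -1)) ` cube n"
proof -
  have "x \<in> cube n \<union> (\<lambda>x. x(n := -1)) ` cube n" if x: "x \<in> cube (Suc n)" for x
  proof (cases "x n = 1")
    case True
    have "x i = 1" if "i \<ge> n" for i
      using x True that by (cases "i = n") (auto simp: cube_def)
    with x show ?thesis by (auto simp: cube_def)
  next
    case False
    have "x n = -1" using x False by (auto simp: cube_def)
    then have "x(n := 1) \<in> cube n" "x = (x(n := 1))(n := -1)"
      using x by (auto simp: cube_def fun_eq_iff)
    then show ?thesis by blast
  qed
  moreover have "cube n \<union> (\<lambda>x. x(n := -1)) ` cube n \<subseteq> cube (Suc n)"
    by (auto simp: cube_def) (metis le_less_linear)+
  ultimately show ?thesis by blast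
qed

lemma finite_cube [simp]: "finite (cube n)"
  by (induction n) (auto simp: cube_0 cube_Suc)

lemma sum_cube_Suc: "(\<Sum>x\<in>cube (Suc n). f x) = (\<Sum>x\<in>cube n. f x + f (x(n := -1)))"
proof -
  have inj: "inj_on (\<lambda>x. x(n := -1)) (cube n)"
  proof (rule inj_onI)
    fix x y assume xy: "x \<in> cube n" "y \<in> cube n" "x(n := -1) = y(n := (-1::real))"
    show "x = y"
    proof
      fix i show "x i = y i"
        using cube_last[OF xy(1)] cube_last[OF xy(2)] fun_cong[OF xy(3), of i]
        by (cases "i = n") (simp_all only: fun_upd_apply if_False)
    qed
  qed
  have "cube n \<inter> (\<lambda>x. x(n := -1)) ` cube n = {}"
  proof -
    have "x n = 1" if "x \<in> cube n" for x using that by (auto simp: cube_def)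
    then show ?thesis by (metis (no_types, lifting) disjoint_iff fun_upd_same image_iff one_neq_neg_one)
  qed
  then show ?thesis
    by (simp add: cube_Suc sum.union_disjoint sum.reindex[OF inj] sum.distrib)
qed

lemma cube_avg_Suc: "cube_avg (Suc n) f = cube_avg n (\<lambda>x. (f x + f (x(n := -1))) / 2)"
  by (simp add: cube_avg_def sum_cube_Suc flip: sum_divide_distrib)

lemma cube_avg_cong: "(\<And>x. x \<in> cube n \<Longrightarrow> f x = g x) \<Longrightarrow> cube_avg n f = cube_avg n g"
  by (simp add: cube_avg_def)

lemma cube_avg_add: "cube_avg n (\<lambda>x. f x + g x) = cube_avg n f + cube_avg n g"
  by (simp add: cube_avg_def sum.distrib add_divide_distrib)

lemma cube_avg_cmult: "cube_avg n (\<lambda>x. c * f x) = c * cube_avg n f"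
  by (simp add: cube_avg_def sum_distrib_left)

lemma cube_avg_sum: "cube_avg n (\<lambda>x. \<Sum>i\<in>I. f i x) = (\<Sum>i\<in>I. cube_avg n (f i))"
  unfolding cube_avg_def by (subst sum.swap) (simp add: sum_divide_distrib)

lemma cube_avg_mono: "(\<And>x. x \<in> cube n \<Longrightarrow> f x \<le> g x) \<Longrightarrow> cube_avg n f \<le> cube_avg n g"
  by (simp add: cube_avg_def divide_right_mono sum_mono)

lemma cube_avg_const [simp]: "cube_avg n (\<lambda>_. c) = c"
  by (induction n) (simp_all add: cube_avg_Suc, simp add: cube_avg_def cube_0)

lemma cube_avg_nonneg: "(\<And>x. 0 \<le> f x) \<Longrightarrow> 0 \<le> cube_avg n f"
  by (simp add: cube_avg_def sum_nonneg)

lemma cube_avg_Cauchy_Schwarz: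
  "(cube_avg n (\<lambda>x. f x * g x))\<^sup>2 \<le> cube_avg n (\<lambda>x. (f x)\<^sup>2) * cube_avg n (\<lambda>x. (g x)\<^sup>2)"
  using Cauchy_Schwarz_ineq_sum[of f g "cube n"]
  by (simp add: cube_avg_def power_divide divide_right_mono flip: power2_eq_square)

lemma sum_Pow_lessThan_Suc:
  fixes g :: "nat set \<Rightarrow> real"
  shows "(\<Sum>S\<in>Pow {..<Suc n}. g S) = (\<Sum>S\<in>Pow {..<n}. g S) + (\<Sum>S\<in>Pow {..<n}. g (insert n S))"
proof -
  have inj: "inj_on (insert n) (Pow {..<n})"
    by (rule inj_onI) (metis Pow_iff insert_ident lessThan_iff less_irrefl subset_iff)
  have "Pow {..<n} \<inter> insert n ` Pow {..<n} = {}" by auto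
  then show ?thesis
    by (simp add: lessThan_Suc Pow_insert sum.union_disjoint sum.reindex[OF inj])
qed

lemma walsh_insert:
  assumes "S \<subseteq> {..<n}" shows "walsh (insert n S) x = x n * walsh S x"
proof -
  have "n \<notin> S" "finite S" using assms finite_subset by auto
  then show ?thesis by (simp add: walsh_def)
qed

lemma walsh_upd: "S \<subseteq> {..<n} \<Longrightarrow> walsh S (x(n := c)) = walsh S x"
  by (auto simp: walsh_def intro!: prod.cong)

text \<open>Sorting the sets by membership of \<open>n\<close> exhibits the sum as affine in the
  last coordinate.\<close>

lemma walsh_sum_Suc:
  "walsh_sum (Suc n) a x = walsh_sum n a x + x n * walsh_sum n (\<lambda>S. a (insert n S)) x"
  by (auto simp: walsh_sum_def sum_Pow_lessThan_Suc walsh_insert sum_distrib_left intro!: sum.cong)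

lemma walsh_sum_upd: "walsh_sum n a (x(n := c)) = walsh_sum n a x"
  by (auto simp: walsh_sum_def walsh_upd intro!: sum.cong)

lemma walsh_sum_cong:
  "(\<And>S. S \<subseteq> {..<n} \<Longrightarrow> a S = b S) \<Longrightarrow> walsh_sum n a x = walsh_sum n b x"
  by (simp add: walsh_sum_def)

lemma walsh_sum_lincomb:
  "walsh_sum n (\<lambda>S. a S + c * b S) x = walsh_sum n a x + c * walsh_sum n b x"
  by (simp add: walsh_sum_def algebra_simps sum.distrib sum_distrib_left)

lemma cube_abs: "x \<in> cube n \<Longrightarrow> \<bar>x i\<bar> = 1"
  by (cases "i < n") (auto simp: cube_def)

lemma parseval:
  "cube_avg n (\<lambda>x. walsh_sum n a x * walsh_sum n b x) = (\<Sum>S\<in>Pow {..<n}. a S * b S)"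
proof (induction n arbitrary: a b)
  case 0
  show ?case by (simp add: cube_avg_def cube_0 walsh_sum_def walsh_def)
next
  case (Suc n)
  let ?a = "\<lambda>S. a (insert n S)" and ?b = "\<lambda>S. b (insert n S)"
  have "cube_avg (Suc n) (\<lambda>x. walsh_sum (Suc n) a x * walsh_sum (Suc n) b x) =
     cube_avg n (\<lambda>x. walsh_sum n a x * walsh_sum n b x + walsh_sum n ?a x * walsh_sum n ?b x)"
    unfolding cube_avg_Suc
    by (rule cube_avg_cong) (simp add: walsh_sum_Suc walsh_sum_upd cube_last algebra_simps)
  then show ?case by (simp add: cube_avg_add Suc.IH sum_Pow_lessThan_Suc)
qed

lemma parseval_square: "cube_avg n (\<lambda>x. (walsh_sum n a x)\<^sup>2) = (\<Sum>S\<in>Pow {..<n}. (a S)\<^sup>2)"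
  using parseval[of n a a] by (simp add: power2_eq_square)

lemma fourier_cube_avg: "fourier n f S = cube_avg n (\<lambda>x. f x * walsh S x)"
  by (simp add: fourier_def cube_avg_def)

text \<open>Induction on \<open>n\<close>, splitting \<open>f\<close> into its even part
  \<open>e\<close> and odd part \<open>o'\<close> in the last coordinate: these carry the
  coefficients of the sets without and with \<open>n\<close>, and \<open>f\<close> is recovered as
  their sum or difference.\<close>

lemma fourier_inversion: "x \<in> cube n \<Longrightarrow> walsh_sum n (fourier n f) x = f x"
proof (induction n arbitrary: f x)
  case 0
  then show ?case by (simp add: fourier_def cube_0 walsh_sum_def walsh_def)
next
  case (Suc n)
  define e where "e = (\<lambda>x. (f x + f (x(n := -1))) / 2)"
  define o' where "o' = (\<lambda>x. (f x - f (x(n := -1))) / 2)"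
  have "fourier (Suc n) f S = fourier n e S" if "S \<subseteq> {..<n}" for S
    unfolding fourier_cube_avg cube_avg_Suc
    by (rule cube_avg_cong) (simp add: walsh_upd that e_def field_simps)
  moreover have "fourier (Suc n) f (insert n S) = fourier n o' S" if "S \<subseteq> {..<n}" for S
    unfolding fourier_cube_avg cube_avg_Suc
    by (rule cube_avg_cong) (simp add: walsh_upd walsh_insert that o'_def cube_last field_simps)
  ultimately have eq: "walsh_sum (Suc n) (fourier (Suc n) f) y =
      walsh_sum n (fourier n e) y + y n * walsh_sum n (fourier n o') y" for y
    by (simp add: walsh_sum_Suc cong: walsh_sum_cong)
  from Suc.prems consider "x \<in> cube n" | y where "y \<in> cube n" "x = y(n := -1)"
    by (auto simp: cube_Suc)
  then show ?case
  proof cases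
    case 1
    then show ?thesis by (simp add: eq Suc.IH cube_last e_def o'_def field_simps)
  next
    case 2
    have "walsh_sum (Suc n) (fourier (Suc n) f) x = e y - o' y"
      by (simp only: eq 2 walsh_sum_upd fun_upd_same Suc.IH[OF 2(1)] mult_minus1 diff_conv_add_uminus)
    also have "\<dots> = f x" unfolding 2(2) e_def o'_def by (simp add: diff_divide_distrib add_divide_distrib)
    finally show ?thesis .
  qed
qed

lemma fourier_walsh:
  assumes "S \<subseteq> {..<n}" "T \<subseteq> {..<n}"
  shows "fourier n (walsh T) S = (if S = T then 1 else 0)"
proof -
  have "walsh U x = walsh_sum n (\<lambda>S. if S = U then 1 else 0) x" if "U \<subseteq> {..<n}" for U x
    using that by (simp add: walsh_sum_def if_distrib[of "\<lambda>c. c * _"] cong: if_cong)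
  then have "fourier n (walsh T) S =
      cube_avg n (\<lambda>x. walsh_sum n (\<lambda>R. if R = T then 1 else 0) x * walsh_sum n (\<lambda>R. if R = S then 1 else 0) x)"
    using assms by (simp add: fourier_cube_avg)
  then show ?thesis using assms by (simp add: parseval if_distrib[of "\<lambda>c. _ * c"] cong: if_cong)
qed

text \<open>Bonami's hypercontractive inequality between the second and fourth moments. Writing the
  sum as \<open>u + x n * v\<close>, the odd powers of the last coordinate average out, and
  \<open>v\<close> has degree one less, which saves a factor 9 that pays for the mixed term.\<close>

lemma bonami:
  assumes "\<And>S. S \<subseteq> {..<n} \<Longrightarrow> card S > d \<Longrightarrow> a S = 0"
  shows "cube_avg n (\<lambda>x. walsh_sum n a x ^ 4) \<le> 9 ^ d * (cube_avg n (\<lambda>x. (walsh_sum n a x)\<^sup>2))\<^sup>2"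
  using assms
proof (induction n arbitrary: a d)
  case 0
  have "(a {})\<^sup>2 ^ 2 \<le> 9 ^ d * (a {})\<^sup>2 ^ 2" using mult_right_mono[of 1 "9^d" "(a {})\<^sup>2 ^ 2"] by simp
  then show ?case by (simp add: cube_avg_def cube_0 walsh_sum_def walsh_def flip: power_mult)
next
  case (Suc n)
  let ?b = "\<lambda>S. a (insert n S)"
  define u where "u = walsh_sum n a"
  define v where "v = walsh_sum n ?b"
  have a0: "a S = 0" if "S \<subseteq> {..<n}" "card S > d" for S
    using Suc.prems[of S] that by (auto simp: lessThan_Suc)
  have b0: "?b S = 0" if "S \<subseteq> {..<n}" "Suc (card S) > d" for S
  proof -
    have "n \<notin> S" "finite S" using that(1) finite_subset by auto
    then show ?thesis using Suc.prems[of "insert n S"] that by (auto simp: lessThan_Suc)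
  qed
  have u4: "cube_avg n (\<lambda>x. u x ^ 4) \<le> 9 ^ d * (cube_avg n (\<lambda>x. (u x)\<^sup>2))\<^sup>2"
    unfolding u_def by (rule Suc.IH) (use a0 in auto)
  define U where "U = cube_avg n (\<lambda>x. (u x)\<^sup>2)"
  define V where "V = cube_avg n (\<lambda>x. (v x)\<^sup>2)"
  have U0: "0 \<le> U" and V0: "0 \<le> V" by (auto simp: U_def V_def intro: cube_avg_nonneg)
  have e2: "cube_avg (Suc n) (\<lambda>x. (walsh_sum (Suc n) a x)\<^sup>2) = U + V"
  proof -
    have "cube_avg (Suc n) (\<lambda>x. (walsh_sum (Suc n) a x)\<^sup>2) = cube_avg n (\<lambda>x. (u x)\<^sup>2 + (v x)\<^sup>2)"
      unfolding cube_avg_Suc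
      by (rule cube_avg_cong)
        (simp add: walsh_sum_Suc walsh_sum_upd cube_last u_def v_def power2_eq_square algebra_simps)
    then show ?thesis by (simp add: cube_avg_add U_def V_def)
  qed
  have e4: "cube_avg (Suc n) (\<lambda>x. walsh_sum (Suc n) a x ^ 4) =
      cube_avg n (\<lambda>x. u x ^ 4) + 6 * cube_avg n (\<lambda>x. (u x)\<^sup>2 * (v x)\<^sup>2) + cube_avg n (\<lambda>x. v x ^ 4)"
  proof -
    have "cube_avg (Suc n) (\<lambda>x. walsh_sum (Suc n) a x ^ 4) =
        cube_avg n (\<lambda>x. u x ^ 4 + 6 * ((u x)\<^sup>2 * (v x)\<^sup>2) + v x ^ 4)"
      unfolding cube_avg_Suc
      by (rule cube_avg_cong)
        (simp add: walsh_sum_Suc walsh_sum_upd cube_last u_def v_def power2_eq_square power4_eq_xxxx algebra_simps)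
    then show ?thesis by (simp add: cube_avg_add cube_avg_cmult)
  qed
  show ?case
  proof (cases d)
    case 0
    then have "v x = 0" for x using b0 by (simp add: v_def walsh_sum_def)
    then show ?thesis using e2 e4 u4 by (simp add: U_def V_def)
  next
    case (Suc e)
    have v4: "cube_avg n (\<lambda>x. v x ^ 4) \<le> 9 ^ e * V\<^sup>2"
      unfolding v_def V_def by (rule Suc.IH) (use b0 Suc in auto)
    have "(cube_avg n (\<lambda>x. (u x)\<^sup>2 * (v x)\<^sup>2))\<^sup>2 \<le> cube_avg n (\<lambda>x. u x ^ 4) * cube_avg n (\<lambda>x. v x ^ 4)"
      using cube_avg_Cauchy_Schwarz[of n "\<lambda>x. (u x)\<^sup>2" "\<lambda>x. (v x)\<^sup>2"] by (simp flip: power_mult)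
    also have "\<dots> \<le> (9 ^ d * U\<^sup>2) * (9 ^ e * V\<^sup>2)"
      using u4 v4 by (intro mult_mono) (auto simp: U_def intro: cube_avg_nonneg)
    \<comment> \<open>As \<open>d = Suc e\<close>, the number \<open>9 ^ d * 9 ^ e\<close> is the
      square of \<open>3 * 9 ^ e\<close>.\<close>
    also have "\<dots> = (3 * 9 ^ e * U * V)\<^sup>2"
      using Suc by (simp add: power2_eq_square)
    finally have sq: "(cube_avg n (\<lambda>x. (u x)\<^sup>2 * (v x)\<^sup>2))\<^sup>2 \<le> (3 * 9 ^ e * U * V)\<^sup>2" .
    have "cube_avg n (\<lambda>x. (u x)\<^sup>2 * (v x)\<^sup>2) \<le> 3 * 9 ^ e * U * V"
      by (rule power2_le_imp_le[OF sq]) (use U0 V0 in simp)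
    then have "cube_avg (Suc n) (\<lambda>x. walsh_sum (Suc n) a x ^ 4) \<le>
        9 ^ d * U\<^sup>2 + 6 * (3 * 9 ^ e * U * V) + 9 ^ e * V\<^sup>2"
      using u4 v4 unfolding e4 U_def[symmetric] by linarith
    \<comment> \<open>The mixed terms agree exactly, since \<open>6 * 3 * 9 ^ e = 2 * 9 ^ d\<close>;
      only the coefficient of \<open>V\<^sup>2\<close> grows.\<close>
    also have "\<dots> \<le> 9 ^ d * (U + V)\<^sup>2"
      using Suc V0 by (simp add: power2_eq_square algebra_simps)
    finally show ?thesis by (simp only: e2)
  qed
qed

text \<open>The left side is the \<open>L\<^sub>2\<close> norm by Parseval. Below a threshold
  \<open>l\<close>, the square of \<open>t\<close> is at most \<open>l * \<bar>t\<bar>\<close>;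
  above it, at most \<open>t ^ 4 / l\<^sup>2\<close>, which Bonami's inequality controls.\<close>

lemma L2_le_L1:
  assumes "\<And>S. S \<subseteq> {..<n} \<Longrightarrow> card S > d \<Longrightarrow> a S = 0"
  shows "sqrt (\<Sum>S\<in>Pow {..<n}. (a S)\<^sup>2) \<le> 3 * 3 ^ d * cube_avg n (\<lambda>x. \<bar>walsh_sum n a x\<bar>)"
proof -
  define V where "V = cube_avg n (\<lambda>x. (walsh_sum n a x)\<^sup>2)"
  define M where "M = cube_avg n (\<lambda>x. \<bar>walsh_sum n a x\<bar>)"
  have V0: "0 \<le> V" and M0: "0 \<le> M" by (auto simp: V_def M_def intro: cube_avg_nonneg)
  have "sqrt V \<le> 3 * 3 ^ d * M"
  proof (cases "V = 0")
    case False
    \<comment> \<open>Chosen so that the fourth-moment term is at most \<open>V / 2\<close> and can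
      be absorbed into the left side.\<close>
    define l where "l = sqrt 2 * 3 ^ d * sqrt V"
    have l0: "l > 0" using False V0 by (simp add: l_def)
    have l2: "l\<^sup>2 = 2 * 9 ^ d * V"
    proof -
      have "((3::real) ^ d)\<^sup>2 = 9 ^ d" by (simp add: power2_eq_square flip: power_mult_distrib)
      then show ?thesis using V0 by (simp add: l_def power_mult_distrib)
    qed
    have pw: "t\<^sup>2 \<le> l * \<bar>t\<bar> + t ^ 4 / l\<^sup>2" for t
    proof (cases "\<bar>t\<bar> \<le> l")
      case True
      have "t\<^sup>2 \<le> l * \<bar>t\<bar>" using mult_right_mono[OF True, of "\<bar>t\<bar>"] by (simp add: power2_eq_square)
      then show ?thesis by (smt (verit) zero_le_divide_iff zero_le_even_power even_numeral)
    next
      case False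
      have "l\<^sup>2 \<le> t\<^sup>2" using False l0 by (metis abs_le_square_iff abs_of_pos less_imp_le not_less)
      then have "t\<^sup>2 * l\<^sup>2 \<le> t ^ 4"
        using mult_left_mono[of "l\<^sup>2" "t\<^sup>2" "t\<^sup>2"] by (simp flip: power_add)
      then have "t\<^sup>2 \<le> t ^ 4 / l\<^sup>2" using l0 by (simp add: le_divide_eq)
      then show ?thesis using l0 by (smt (verit) mult_nonneg_nonneg)
    qed
    have "V \<le> cube_avg n (\<lambda>x. l * \<bar>walsh_sum n a x\<bar> + (1 / l\<^sup>2) * walsh_sum n a x ^ 4)"
      unfolding V_def using pw by (intro cube_avg_mono) simp
    also have "\<dots> = l * M + (1 / l\<^sup>2) * cube_avg n (\<lambda>x. walsh_sum n a x ^ 4)"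
      by (simp only: cube_avg_add cube_avg_cmult M_def)
    also have "\<dots> \<le> l * M + (1 / l\<^sup>2) * (9 ^ d * V\<^sup>2)"
      using bonami[of n d a] assms unfolding V_def by (intro add_left_mono mult_left_mono) auto
    also have "(1 / l\<^sup>2) * (9 ^ d * V\<^sup>2) = V / 2"
      unfolding l2 using False by (simp add: power2_eq_square)
    finally have "V \<le> 2 * l * M" by simp
    then have "sqrt V * sqrt V \<le> sqrt V * (2 * sqrt 2 * 3 ^ d * M)"
      using V0 by (simp add: l_def mult_ac)
    then have "sqrt V \<le> 2 * sqrt 2 * 3 ^ d * M"
      by (rule mult_left_le_imp_le) (use False V0 in simp)
    also have "\<dots> \<le> 3 * 3 ^ d * M"
    proof -
      have "sqrt 2 \<le> 3 / 2" by (rule real_le_lsqrt) (auto simp: power2_eq_square)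
      then show ?thesis using M0 by (intro mult_right_mono) auto
    qed
    finally show ?thesis .
  qed (use M0 in simp)
  then show ?thesis by (simp add: V_def M_def parseval_square)
qed

text \<open>A function affine in each coordinate attains its extremes over a box at the vertices.
  The induction freezes the last coordinate at \<open>x n\<close> by folding it into the
  coefficients.\<close>

lemma walsh_sum_bounded_on_box:
  assumes "\<And>x. x \<in> cube n \<Longrightarrow> \<bar>walsh_sum n a x\<bar> \<le> B" "\<And>i. i < n \<Longrightarrow> \<bar>x i\<bar> \<le> 1"
  shows "\<bar>walsh_sum n a x\<bar> \<le> B"
  using assms
proof (induction n arbitrary: a)
  case 0
  from 0(1)[of "\<lambda>_. 1"] show ?case by (simp add: cube_0 walsh_sum_def walsh_def)
next
  case (Suc n)
  let ?b = "\<lambda>S. a (insert n S)"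
  have "\<bar>walsh_sum n (\<lambda>S. a S + x n * ?b S) x\<bar> \<le> B"
  proof (rule Suc.IH)
    fix y assume y: "y \<in> cube n"
    define u v where "u = walsh_sum n a y" and "v = walsh_sum n ?b y"
    have "\<bar>u + v\<bar> \<le> B"
      using Suc.prems(1)[of y] y by (simp add: cube_Suc walsh_sum_Suc cube_last u_def v_def)
    moreover have "\<bar>u - v\<bar> \<le> B"
    proof -
      have "y(n := -1) \<in> cube (Suc n)" using y by (auto simp: cube_Suc)
      from Suc.prems(1)[OF this] show ?thesis
        by (simp only: walsh_sum_Suc walsh_sum_upd u_def v_def fun_upd_same mult_minus1 diff_conv_add_uminus)
    qed
    moreover have "\<bar>x n * v\<bar> \<le> \<bar>v\<bar>"
      using Suc.prems(2)[of n] by (simp add: abs_mult mult_left_le_one_le)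
    ultimately have "\<bar>u + x n * v\<bar> \<le> B" by linarith
    then show "\<bar>walsh_sum n (\<lambda>S. a S + x n * ?b S) y\<bar> \<le> B"
      by (simp only: walsh_sum_lincomb u_def v_def)
  qed (use Suc.prems in auto)
  then show ?case by (simp only: walsh_sum_lincomb walsh_sum_Suc)
qed

subsection \<open>A Bohnenblust--Hille inequality for low-degree parts\<close>

text \<open>Along t \<mapsto> t x, coefficient \<open>j\<close> is the homogeneous part of degree
  \<open>j\<close> at \<open>x\<close>. Markov's inequality bounds it by \<open>B * k ^ j\<close>,
  and \<open>d + 1\<close> such parts are added.\<close>

lemma low_degree_part_bounded:
  assumes "\<And>S. S \<subseteq> {..<n} \<Longrightarrow> card S > k \<Longrightarrow> a S = 0"
    and "\<And>x. x \<in> cube n \<Longrightarrow> \<bar>walsh_sum n a x\<bar> \<le> B" and "x \<in> cube n" "1 \<le> k"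
  shows "\<bar>walsh_sum n (\<lambda>S. if card S \<le> d then a S else 0) x\<bar> \<le> (real d + 1) * B * real k ^ d"
proof -
  define p where "p = (\<Sum>S\<in>Pow {..<n}. monom (a S * walsh S x) (card S))"
  have B0: "0 \<le> B" using assms(2)[OF assms(3)] by linarith
  have "degree p \<le> k"
    unfolding p_def
  proof (rule degree_sum_le)
    fix S assume "S \<in> Pow {..<n}"
    then show "degree (monom (a S * walsh S x) (card S)) \<le> k"
      using assms(1)[of S] by (cases "card S > k") (auto intro: order_trans[OF degree_monom_le])
  qed simp
  moreover have "\<bar>poly p t\<bar> \<le> B" if "\<bar>t\<bar> \<le> 1" for t
  proof -
    have "poly p t = walsh_sum n a (\<lambda>i. t * x i)"
      by (simp add: p_def poly_sum poly_monom walsh_sum_def walsh_def prod.distrib mult_ac)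
    also have "\<bar>\<dots>\<bar> \<le> B"
      by (rule walsh_sum_bounded_on_box[OF assms(2)]) (use that cube_abs[OF assms(3)] in \<open>auto simp: abs_mult\<close>)
    finally show ?thesis .
  qed
  ultimately have coeff: "\<bar>coeff p j\<bar> \<le> B * real k ^ j" for j
    by (rule coeff_le_of_bounded)
  have "walsh_sum n (\<lambda>S. if card S \<le> d then a S else 0) x = (\<Sum>j\<le>d. coeff p j)"
    unfolding p_def coeff_sum coeff_monom walsh_sum_def
    by (subst sum.swap) (auto intro!: sum.cong)
  also have "\<bar>\<dots>\<bar> \<le> (\<Sum>j\<le>d. \<bar>coeff p j\<bar>)" by (rule sum_abs)
  also have "\<dots> \<le> (\<Sum>j\<le>d. B * real k ^ d)"
    using assms(4) B0 by (intro sum_mono order_trans[OF coeff] mult_left_mono power_increasing) auto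
  finally show ?thesis by (simp add: algebra_simps)
qed

text \<open>Describes a Walsh monomial along the line through \<open>u\<close> with direction
  \<open>v\<close>; by the product rule, the coefficient of index 1 is the directional derivative at
  \<open>u\<close>.\<close>

lemma coeff_prod_linear:
  fixes u v :: "'i \<Rightarrow> real"
  assumes "finite S"
  shows "coeff (\<Prod>i\<in>S. [:u i, v i:]) 0 = (\<Prod>i\<in>S. u i)"
    and "coeff (\<Prod>i\<in>S. [:u i, v i:]) 1 = (\<Sum>i\<in>S. v i * (\<Prod>j\<in>S - {i}. u j))"
    and "degree (\<Prod>i\<in>S. [:u i, v i:]) \<le> card S"
proof -
  show c0: "coeff (\<Prod>i\<in>S. [:u i, v i:]) 0 = (\<Prod>i\<in>S. u i)" for S
    by (simp add: poly_prod flip: poly_0_coeff_0)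
  show "coeff (\<Prod>i\<in>S. [:u i, v i:]) 1 = (\<Sum>i\<in>S. v i * (\<Prod>j\<in>S - {i}. u j))"
    using assms
  proof (induction S)
    case (insert s S)
    have "(\<Sum>i\<in>S. v i * (\<Prod>j\<in>insert s S - {i}. u j)) = (\<Sum>i\<in>S. u s * (v i * (\<Prod>j\<in>S - {i}. u j)))"
    proof (rule sum.cong)
      fix i assume "i \<in> S"
      then have "insert s S - {i} = insert s (S - {i})" using insert by auto
      then show "v i * (\<Prod>j\<in>insert s S - {i}. u j) = u s * (v i * (\<Prod>j\<in>S - {i}. u j))"
        using insert by simp
    qed simp
    then show ?case using insert c0[of S]
      by (simp add: sum_distrib_left)
  qed simp
  have "degree (\<Prod>i\<in>S. [:u i, v i:]) \<le> (\<Sum>i\<in>S. degree [:u i, v i:])"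
    using degree_prod_sum_le[OF assms, of "\<lambda>i. [:u i, v i:]"] by (simp add: o_def)
  also have "\<dots> \<le> (\<Sum>i\<in>S. 1)" by (intro sum_mono) auto
  finally show "degree (\<Prod>i\<in>S. [:u i, v i:]) \<le> card S" by simp
qed

lemma sum_Pow_remove:
  fixes g :: "nat set \<Rightarrow> real"
  assumes "i < n"
  shows "(\<Sum>S\<in>Pow {..<n}. if i \<in> S then g S else 0) =
    (\<Sum>T\<in>Pow {..<n}. if i \<in> T then 0 else g (insert i T))"
proof -
  have "(\<Sum>S\<in>Pow {..<n}. if i \<in> S then g S else 0) = (\<Sum>S\<in>{S\<in>Pow {..<n}. i \<in> S}. g S)"
    by (simp add: sum.If_cases Int_def)
  also have "\<dots> = (\<Sum>T\<in>{T\<in>Pow {..<n}. i \<notin> T}. g (insert i T))"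
    using assms
    by (intro sum.reindex_bij_witness[where i = "insert i" and j = "\<lambda>S. S - {i}"])
      (auto simp: insert_absorb)
  also have "\<dots> = (\<Sum>T\<in>Pow {..<n}. if i \<in> T then 0 else g (insert i T))"
    by (rule sum.mono_neutral_cong_left) auto
  finally show ?thesis .
qed

text \<open>The coefficients of \<open>x \<mapsto> \<partial>\<^sub>i g(x/2)\<close>, where \<open>b\<close> are the coefficients of \<open>g\<close>.\<close>
definition half_deriv :: "(nat set \<Rightarrow> real) \<Rightarrow> nat \<Rightarrow> nat set \<Rightarrow> real" where
  "half_deriv b i T = (if i \<in> T then 0 else b (insert i T) / 2 ^ card T)"

text \<open>For a suitable sign vector \<open>y\<close>, the derivative at \<open>x / 2\<close> in
  direction \<open>y / 2\<close> is half the sum of the absolute partial derivatives. The segment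
  \<open>x / 2 + t * (y / 2)\<close> stays in the box for \<open>\<bar>t\<bar> \<le> 1\<close>, so
  Markov's inequality with index 1 applies.\<close>

lemma sum_half_derivs_bounded:
  assumes "\<And>S. S \<subseteq> {..<n} \<Longrightarrow> card S > d \<Longrightarrow> b S = 0"
    and "\<And>x. x \<in> cube n \<Longrightarrow> \<bar>walsh_sum n b x\<bar> \<le> B" and "x \<in> cube n"
  shows "(\<Sum>i<n. \<bar>walsh_sum n (half_deriv b i) x\<bar>) \<le> 2 * real d * B"
proof -
  define D where "D = (\<lambda>i. walsh_sum n (half_deriv b i) x)"
  \<comment> \<open>The signs of the partial derivatives, so that their contributions add up without
    cancellation.\<close>
  define y where "y = (\<lambda>i. if D i \<ge> 0 then 1 else -1 :: real)"
  define p where "p = (\<Sum>S\<in>Pow {..<n}. smult (b S) (\<Prod>i\<in>S. [:x i / 2, y i / 2:]))"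
  have fin: "finite S" if "S \<in> Pow {..<n}" for S using that finite_subset by auto
  have "degree p \<le> d"
    unfolding p_def
  proof (rule degree_sum_le)
    fix S assume S: "S \<in> Pow {..<n}"
    then show "degree (smult (b S) (\<Prod>i\<in>S. [:x i / 2, y i / 2:])) \<le> d"
      using assms(1)[of S] coeff_prod_linear(3)[OF fin[OF S], of "\<lambda>i. x i / 2" "\<lambda>i. y i / 2"]
      by (cases "card S > d") auto
  qed simp
  moreover have "\<bar>poly p t\<bar> \<le> B" if "\<bar>t\<bar> \<le> 1" for t
  proof -
    have "poly p t = walsh_sum n b (\<lambda>i. x i / 2 + t * (y i / 2))"
      by (simp add: p_def poly_sum poly_prod walsh_sum_def walsh_def)
    also have "\<bar>\<dots>\<bar> \<le> B"
    proof (rule walsh_sum_bounded_on_box[OF assms(2)])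
      fix i
      have "\<bar>t * y i\<bar> \<le> 1" "\<bar>x i\<bar> \<le> 1" using that cube_abs[OF assms(3), of i] by (auto simp: abs_mult y_def)
      then show "\<bar>x i / 2 + t * (y i / 2)\<bar> \<le> 1" by (simp add: abs_le_iff)
    qed simp
    finally show ?thesis .
  qed
  ultimately have "\<bar>coeff p 1\<bar> \<le> B * real d ^ 1"
    by (rule coeff_le_of_bounded)
  moreover have "coeff p 1 = (\<Sum>i<n. \<bar>D i\<bar>) / 2"
  proof -
    have "coeff p 1 = (\<Sum>S\<in>Pow {..<n}. \<Sum>i\<in>S. y i / 2 * (b S * walsh (S - {i}) x / 2 ^ card (S - {i})))"
      unfolding p_def coeff_sum coeff_smult
      by (intro sum.cong refl, subst coeff_prod_linear(2)[OF fin])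
        (auto simp: sum_distrib_left walsh_def prod_dividef mult_ac intro!: sum.cong)
    also have "\<dots> = (\<Sum>S\<in>Pow {..<n}. \<Sum>i<n. if i \<in> S then y i / 2 * (b S * walsh (S - {i}) x / 2 ^ card (S - {i})) else 0)"
      by (rule sum.cong[OF refl], rule sum.mono_neutral_cong_left) auto
    also have "\<dots> = (\<Sum>i<n. \<Sum>S\<in>Pow {..<n}. if i \<in> S then y i / 2 * (b S * walsh (S - {i}) x / 2 ^ card (S - {i})) else 0)"
      by (rule sum.swap)
    also have "\<dots> = (\<Sum>i<n. \<bar>D i\<bar> / 2)"
    proof (rule sum.cong)
      fix i assume "i \<in> {..<n}"
      then have "(\<Sum>S\<in>Pow {..<n}. if i \<in> S then y i / 2 * (b S * walsh (S - {i}) x / 2 ^ card (S - {i})) else 0)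
         = (\<Sum>T\<in>Pow {..<n}. if i \<in> T then 0 else y i / 2 * (b (insert i T) * walsh (insert i T - {i}) x / 2 ^ card (insert i T - {i})))"
        by (intro sum_Pow_remove) auto
      also have "\<dots> = y i / 2 * D i"
        unfolding D_def walsh_sum_def sum_distrib_left
        by (intro sum.cong) (auto simp: half_deriv_def)
      also have "\<dots> = \<bar>D i\<bar> / 2" by (simp add: y_def)
      finally show "(\<Sum>S\<in>Pow {..<n}. if i \<in> S then y i / 2 * (b S * walsh (S - {i}) x / 2 ^ card (S - {i})) else 0) = \<bar>D i\<bar> / 2" .
    qed simp
    finally show ?thesis by (simp add: sum_divide_distrib)
  qed
  ultimately have "(\<Sum>i<n. \<bar>D i\<bar>) / 2 \<le> B * real d" by simp
  then show ?thesis by (simp add: D_def mult_ac)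
qed

text \<open>The roots are the \<open>L\<^sub>2\<close> norms of the partial derivatives. Passing to
  half points costs at most \<open>2 ^ d\<close>, passing to \<open>L\<^sub>1\<close> costs
  \<open>3 * 3 ^ d\<close>; the pointwise bound on the sum is then averaged over the cube.\<close>

lemma sum_influences_le:
  assumes "\<And>S. S \<subseteq> {..<n} \<Longrightarrow> card S > d \<Longrightarrow> b S = 0"
    and "\<And>x. x \<in> cube n \<Longrightarrow> \<bar>walsh_sum n b x\<bar> \<le> B"
  shows "(\<Sum>i<n. sqrt (\<Sum>S\<in>Pow {..<n}. if i \<in> S then (b S)\<^sup>2 else 0)) \<le> 6 * 6 ^ d * real d * B"
proof -
  have "sqrt (\<Sum>S\<in>Pow {..<n}. if i \<in> S then (b S)\<^sup>2 else 0)
      \<le> 3 * 6 ^ d * cube_avg n (\<lambda>x. \<bar>walsh_sum n (half_deriv b i) x\<bar>)" if i: "i < n" for i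
  proof -
    have z: "b (insert i T) = 0" if "T \<subseteq> {..<n}" "i \<notin> T" "card T > d" for T
      using assms(1)[of "insert i T"] that i finite_subset[OF that(1)] by auto
    have "(\<Sum>S\<in>Pow {..<n}. if i \<in> S then (b S)\<^sup>2 else 0) =
        (\<Sum>T\<in>Pow {..<n}. if i \<in> T then 0 else (b (insert i T))\<^sup>2)"
      using i by (rule sum_Pow_remove)
    also have "\<dots> \<le> (\<Sum>T\<in>Pow {..<n}. 4 ^ d * (half_deriv b i T)\<^sup>2)"
    proof (rule sum_mono)
      fix T assume T: "T \<in> Pow {..<n}"
      show "(if i \<in> T then 0 else (b (insert i T))\<^sup>2) \<le> 4 ^ d * (half_deriv b i T)\<^sup>2"
      proof (cases "i \<notin> T \<and> card T \<le> d")
        case True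
        have "(b (insert i T))\<^sup>2 = 4 ^ card T * (half_deriv b i T)\<^sup>2"
          using True by (simp add: half_deriv_def power2_eq_square flip: power_mult_distrib)
        also have "\<dots> \<le> 4 ^ d * (half_deriv b i T)\<^sup>2"
          using True by (intro mult_right_mono power_increasing) auto
        finally show ?thesis using True by simp
      next
        case False
        then show ?thesis using z[of T] T by auto
      qed
    qed
    finally have "sqrt (\<Sum>S\<in>Pow {..<n}. if i \<in> S then (b S)\<^sup>2 else 0)
        \<le> sqrt (4 ^ d * (\<Sum>T\<in>Pow {..<n}. (half_deriv b i T)\<^sup>2))"
      by (simp add: sum_distrib_left)
    also have "\<dots> = 2 ^ d * sqrt (\<Sum>T\<in>Pow {..<n}. (half_deriv b i T)\<^sup>2)"
      by (simp add: real_sqrt_mult real_sqrt_power)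
    also have "\<dots> \<le> 2 ^ d * (3 * 3 ^ d * cube_avg n (\<lambda>x. \<bar>walsh_sum n (half_deriv b i) x\<bar>))"
      by (intro mult_left_mono L2_le_L1) (use z in \<open>auto simp: half_deriv_def\<close>)
    also have "\<dots> = 3 * 6 ^ d * cube_avg n (\<lambda>x. \<bar>walsh_sum n (half_deriv b i) x\<bar>)"
      by (simp flip: power_mult_distrib)
    finally show ?thesis .
  qed
  then have "(\<Sum>i<n. sqrt (\<Sum>S\<in>Pow {..<n}. if i \<in> S then (b S)\<^sup>2 else 0))
      \<le> (\<Sum>i<n. 3 * 6 ^ d * cube_avg n (\<lambda>x. \<bar>walsh_sum n (half_deriv b i) x\<bar>))"
    by (intro sum_mono) auto
  also have "\<dots> = 3 * 6 ^ d * cube_avg n (\<lambda>x. \<Sum>i<n. \<bar>walsh_sum n (half_deriv b i) x\<bar>)"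
    by (simp add: cube_avg_sum sum_distrib_left)
  also have "\<dots> \<le> 3 * 6 ^ d * cube_avg n (\<lambda>x. 2 * real d * B)"
    using sum_half_derivs_bounded[OF assms] by (intro mult_left_mono cube_avg_mono) auto
  finally show ?thesis by simp
qed

text \<open>A geometric mean is at most the sum of its terms; apply this to the \<open>card S + 1\<close> numbers
  \<open>c\<^sup>2 / m i\<close> and \<open>\<Prod>i\<in>S. m i\<close>, whose product is \<open>c ^ (2 * card S)\<close>.\<close>
lemma powr_le_sum_plus_prod:
  fixes c :: real
  assumes "finite S" "card S \<le> d" "0 \<le> c" "c \<le> 1" "\<And>i. i \<in> S \<Longrightarrow> c \<le> m i"
  shows "c powr (2 * real d / (real d + 1)) \<le> (\<Sum>i\<in>S. c\<^sup>2 / m i) + (\<Prod>i\<in>S. m i)"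
proof (cases "c = 0")
  case True
  have "0 \<le> (\<Prod>i\<in>S. m i)" using assms True by (intro prod_nonneg) auto
  then show ?thesis using True by simp
next
  case False
  then have c: "c > 0" using assms by simp
  have m: "m i > 0" if "i \<in> S" for i using assms(5)[OF that] c by simp
  define z where "z = c powr (2 * real d / (real d + 1))"
  define j where "j = card S"
  have P: "0 < (\<Prod>i\<in>S. m i)" using m by (intro prod_pos) auto
  show ?thesis
  proof (rule ccontr)
    assume "\<not> ?thesis"
    then have big: "z > (\<Sum>i\<in>S. c\<^sup>2 / m i) + (\<Prod>i\<in>S. m i)" by (simp add: z_def)
    have zP: "z > (\<Prod>i\<in>S. m i)"
      using big sum_nonneg[of S "\<lambda>i. c\<^sup>2 / m i"] m by (smt (verit) divide_nonneg_pos zero_le_power2)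
    have zi: "c\<^sup>2 / m i \<le> z" if "i \<in> S" for i
    proof -
      have "c\<^sup>2 / m i \<le> (\<Sum>i\<in>S. c\<^sup>2 / m i)"
        using that assms(1) m by (intro member_le_sum) (auto intro: divide_nonneg_pos)
      then show ?thesis using big P by linarith
    qed
    have "c ^ (2 * j) = (\<Prod>i\<in>S. c\<^sup>2 / m i) * (\<Prod>i\<in>S. m i)"
      using P by (simp add: prod_dividef j_def power_mult)
    also have "\<dots> \<le> (\<Prod>i\<in>S. z) * (\<Prod>i\<in>S. m i)"
      using zi m P by (intro mult_right_mono prod_mono) (auto intro: divide_nonneg_pos)
    also have "\<dots> < (\<Prod>i\<in>S. z) * z"
      using zP P by (intro mult_strict_left_mono) auto
    also have "\<dots> = z ^ (j + 1)" by (simp add: j_def)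
    also have "\<dots> = c powr (2 * real d / (real d + 1) * real (j + 1))"
      using c unfolding z_def powr_powr[symmetric] by (subst powr_realpow) auto
    \<comment> \<open>Powers of \<open>c \<le> 1\<close> decrease in the exponent, and the required
      comparison of exponents amounts to \<open>j \<le> d\<close>.\<close>
    also have "\<dots> \<le> c powr (real (2 * j))"
    proof (rule powr_mono')
      have "real (2 * j) * (real d + 1) \<le> 2 * real d * real (j + 1)"
        using assms(2) by (simp add: j_def algebra_simps)
      then show "real (2 * j) \<le> 2 * real d / (real d + 1) * real (j + 1)"
        by (simp add: field_simps)
    qed (use c assms in auto)
    also have "\<dots> = c ^ (2 * j)" using c by (rule powr_realpow)
    finally show False by simp
  qed
qed

text \<open>After division by \<open>A\<close> the quantities \<open>m i\<close> sum to at most 1.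
  The terms \<open>(c S)\<^sup>2 / m i\<close> add up to the sum of the \<open>m i\<close>, and the
  products add up to the product of the \<open>m i + 1\<close>, which is at most
  \<open>exp 1 \<le> 3\<close>; hence the bound 1 + 3.\<close>

lemma sum_powr_le_of_influences:
  fixes b :: "nat set \<Rightarrow> real"
  assumes "\<And>S. S \<subseteq> {..<n} \<Longrightarrow> card S > d \<Longrightarrow> b S = 0" "A > 0"
    and infl: "(\<Sum>i<n. sqrt (\<Sum>S\<in>Pow {..<n}. if i \<in> S then (b S)\<^sup>2 else 0)) \<le> A"
    and le: "\<And>S. S \<subseteq> {..<n} \<Longrightarrow> \<bar>b S\<bar> \<le> A"
  shows "(\<Sum>S\<in>Pow {..<n}. (\<bar>b S\<bar> / A) powr (2 * real d / (real d + 1))) \<le> 4"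
proof -
  define c where "c = (\<lambda>S. \<bar>b S\<bar> / A)"
  define m where "m = (\<lambda>i. sqrt (\<Sum>S\<in>Pow {..<n}. if i \<in> S then (c S)\<^sup>2 else 0))"
  have m_eq: "m i = sqrt (\<Sum>S\<in>Pow {..<n}. if i \<in> S then (b S)\<^sup>2 else 0) / A" for i
  proof -
    have "(\<Sum>S\<in>Pow {..<n}. if i \<in> S then (c S)\<^sup>2 else 0) = (\<Sum>S\<in>Pow {..<n}. if i \<in> S then (b S)\<^sup>2 else 0) / A\<^sup>2"
      by (auto simp: c_def power_divide sum_divide_distrib intro!: sum.cong)
    then show ?thesis using assms(2) by (simp add: m_def real_sqrt_divide)
  qed
  have m1: "(\<Sum>i<n. m i) \<le> 1"
    using infl assms(2) by (simp add: m_eq flip: sum_divide_distrib)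
  have m0: "0 \<le> m i" for i by (auto simp: m_def intro!: sum_nonneg)
  have m2: "(m i)\<^sup>2 = (\<Sum>S\<in>Pow {..<n}. if i \<in> S then (c S)\<^sup>2 else 0)" for i
    unfolding m_def by (intro real_sqrt_pow2 sum_nonneg) auto
  have cm: "c S \<le> m i" if "S \<subseteq> {..<n}" "i \<in> S" for S i
  proof -
    have "(c S)\<^sup>2 = (if i \<in> S then (c S)\<^sup>2 else 0)" using that by simp
    also have "\<dots> \<le> (m i)\<^sup>2" unfolding m2 by (rule member_le_sum) (use that in auto)
    finally show ?thesis using m0 by (rule power2_le_imp_le)
  qed
  have c01: "0 \<le> c S" "S \<subseteq> {..<n} \<Longrightarrow> c S \<le> 1" for S
    using assms(2) le[of S] by (auto simp: c_def)
  have "(\<Sum>S\<in>Pow {..<n}. c S powr (2 * real d / (real d + 1)))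
      \<le> (\<Sum>S\<in>Pow {..<n}. (\<Sum>i\<in>S. (c S)\<^sup>2 / m i) + (\<Prod>i\<in>S. m i))"
  proof (rule sum_mono)
    fix S assume S: "S \<in> Pow {..<n}"
    show "c S powr (2 * real d / (real d + 1)) \<le> (\<Sum>i\<in>S. (c S)\<^sup>2 / m i) + (\<Prod>i\<in>S. m i)"
    proof (cases "card S \<le> d")
      case True
      then show ?thesis using S c01 cm finite_subset[of S "{..<n}"]
        by (intro powr_le_sum_plus_prod) auto
    next
      case False
      then have "c S = 0" using assms(1)[of S] S by (simp add: c_def)
      then show ?thesis using m0 by (simp add: prod_nonneg)
    qed
  qed
  also have "\<dots> = (\<Sum>S\<in>Pow {..<n}. \<Sum>i\<in>S. (c S)\<^sup>2 / m i) + (\<Sum>S\<in>Pow {..<n}. \<Prod>i\<in>S. m i)"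
    by (rule sum.distrib)
  also have "(\<Sum>S\<in>Pow {..<n}. \<Sum>i\<in>S. (c S)\<^sup>2 / m i) = (\<Sum>i<n. m i)"
  proof -
    have "(\<Sum>S\<in>Pow {..<n}. \<Sum>i\<in>S. (c S)\<^sup>2 / m i) =
        (\<Sum>S\<in>Pow {..<n}. \<Sum>i<n. (if i \<in> S then (c S)\<^sup>2 else 0) / m i)"
      by (rule sum.cong[OF refl], rule sum.mono_neutral_cong_left) auto
    also have "\<dots> = (\<Sum>i<n. \<Sum>S\<in>Pow {..<n}. (if i \<in> S then (c S)\<^sup>2 else 0) / m i)"
      by (rule sum.swap)
    \<comment> \<open>The inner sum is \<open>(m i)\<^sup>2 / m i\<close>, which equals
      \<open>m i\<close> even for \<open>m i = 0\<close>, as division by zero gives 0.\<close>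
    also have "\<dots> = (\<Sum>i<n. m i)"
      by (intro sum.cong refl) (simp flip: sum_divide_distrib m2 add: power2_eq_square)
    finally show ?thesis .
  qed
  also have "(\<Sum>S\<in>Pow {..<n}. \<Prod>i\<in>S. m i) = (\<Prod>i<n. m i + 1)"
    by (simp add: prod_add)
  also have "\<dots> \<le> (\<Prod>i<n. exp (m i))"
    using m0 exp_ge_add_one_self by (intro prod_mono) (auto simp: add.commute add_nonneg_nonneg)
  also have "\<dots> = exp (\<Sum>i<n. m i)" by (simp add: exp_sum)
  also have "\<dots> \<le> exp 1" using m1 by simp
  also have "\<dots> \<le> 3" by (rule exp_le)
  finally show ?thesis using m1 by (simp add: c_def)
qed

subsection \<open>Duality\<close>

definition sublinear :: "(('a \<Rightarrow> real) \<Rightarrow> real) \<Rightarrow> bool" where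
  "sublinear p \<longleftrightarrow> (\<forall>u v. p (\<lambda>x. u x + v x) \<le> p u + p v) \<and> (\<forall>c u. 0 \<le> c \<longrightarrow> p (\<lambda>x. c * u x) = c * p u)"

text \<open>The other half of homogeneity follows by applying the scaling inequality with factor
  \<open>1 / c\<close> to the multiple of \<open>u\<close> by \<open>c\<close>.\<close>

lemma sublinearI:
  assumes "\<And>u v. p (\<lambda>x. u x + v x) \<le> p u + p v" "\<And>c u. 0 < c \<Longrightarrow> p (\<lambda>x. c * u x) \<le> c * p u"
    "p (\<lambda>_. 0) = 0"
  shows "sublinear p"
  unfolding sublinear_def
proof (intro conjI allI impI)
  fix c :: real and u assume c: "0 \<le> c"
  show "p (\<lambda>x. c * u x) = c * p u"
  proof (cases "c = 0")
    case False
    have "p (\<lambda>x. (1 / c) * (c * u x)) \<le> (1 / c) * p (\<lambda>x. c * u x)"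
      using c False by (intro assms(2)) auto
    then have "c * p u \<le> p (\<lambda>x. c * u x)" using c False by (simp add: field_simps)
    then show ?thesis using assms(2)[of c u] c False by simp
  qed (simp add: assms(3))
qed (rule assms(1))

lemma sublinear_add: "sublinear p \<Longrightarrow> p (\<lambda>x. u x + v x) \<le> p u + p v"
  by (simp add: sublinear_def)

lemma sublinear_scale: "sublinear p \<Longrightarrow> 0 \<le> c \<Longrightarrow> p (\<lambda>x. c * u x) = c * p u"
  by (simp add: sublinear_def)

lemma sublinear_zero: "sublinear p \<Longrightarrow> p (\<lambda>_. 0) = 0"
  using sublinear_scale[of p 0] by simp

lemma sublinear_minus: "sublinear p \<Longrightarrow> - p (\<lambda>x. - u x) \<le> p u"
  using sublinear_add[of p u "\<lambda>x. - u x"] sublinear_zero[of p] by simp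

lemma le_add_INF:
  fixes f :: "'a \<Rightarrow> real" and g :: "'b \<Rightarrow> real"
  assumes "A \<noteq> {}" "B \<noteq> {}" "\<And>s t. s \<in> A \<Longrightarrow> t \<in> B \<Longrightarrow> z \<le> f s + g t"
  shows "z \<le> (INF s\<in>A. f s) + (INF t\<in>B. g t)"
proof -
  have "z - f s \<le> (INF t\<in>B. g t)" if "s \<in> A" for s
    using assms that by (intro cINF_greatest) (auto simp: algebra_simps)
  then have "z - (INF t\<in>B. g t) \<le> (INF s\<in>A. f s)"
    using assms(1) by (intro cINF_greatest) (auto simp: algebra_simps)
  then show ?thesis by simp
qed

lemma le_mult_INF:
  fixes f :: "'a \<Rightarrow> real"
  assumes "A \<noteq> {}" "c > 0" "\<And>s. s \<in> A \<Longrightarrow> z \<le> c * f s"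
  shows "z \<le> c * (INF s\<in>A. f s)"
proof -
  have "z / c \<le> (INF s\<in>A. f s)"
    using assms by (intro cINF_greatest) (auto simp: field_simps)
  then show ?thesis using assms(2) by (simp add: field_simps)
qed

text \<open>One Hahn-Banach step: \<open>q\<close> minimises \<open>p (v + t e) - t * p e\<close>
  over \<open>t \<ge> 0\<close>, a quantity bounded below by \<open>- p (- v)\<close>. Together with
  \<open>q \<le> p\<close>, the last property makes \<open>q\<close> linear along \<open>e\<close>,
  with the value of \<open>p\<close> at \<open>e\<close> retained.\<close>

lemma sublinear_refine:
  assumes p: "sublinear p"
  obtains q where "sublinear q" "\<And>v. q v \<le> p v" "q (\<lambda>x. - e x) \<le> - p e"
proof -
  define q where "q v = (INF t\<in>{0..}. p (\<lambda>x. v x + t * e x) - t * p e)" for v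
  have bdd: "bdd_below ((\<lambda>t. p (\<lambda>x. v x + t * e x) - t * p e) ` {0..})" for v
  proof (rule bdd_belowI2)
    fix t :: real assume "t \<in> {0..}"
    then show "- p (\<lambda>x. - v x) \<le> p (\<lambda>x. v x + t * e x) - t * p e"
      using sublinear_add[OF p, of "\<lambda>x. v x + t * e x" "\<lambda>x. - v x"] sublinear_scale[OF p, of t e] by simp
  qed
  have le: "q v \<le> p (\<lambda>x. v x + t * e x) - t * p e" if "0 \<le> t" for v t
    unfolding q_def using bdd that by (intro cINF_lower) auto
  have "sublinear q"
  proof (rule sublinearI)
    fix u v
    show "q (\<lambda>x. u x + v x) \<le> q u + q v"
      unfolding q_def[of u] q_def[of v]
    proof (rule le_add_INF, goal_cases)
      case (3 s t)
      have "q (\<lambda>x. u x + v x) \<le> p (\<lambda>x. (u x + v x) + (s + t) * e x) - (s + t) * p e"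
        using 3 by (intro le) auto
      also have "(\<lambda>x. (u x + v x) + (s + t) * e x) = (\<lambda>x. (u x + s * e x) + (v x + t * e x))"
        by (simp add: algebra_simps)
      also have "p \<dots> \<le> p (\<lambda>x. u x + s * e x) + p (\<lambda>x. v x + t * e x)"
        by (rule sublinear_add[OF p])
      finally show ?case by (simp add: algebra_simps)
    qed auto
  next
    fix c :: real and u assume c: "0 < c"
    show "q (\<lambda>x. c * u x) \<le> c * q u"
      unfolding q_def[of u]
    proof (rule le_mult_INF, goal_cases)
      case (3 s)
      have "q (\<lambda>x. c * u x) \<le> p (\<lambda>x. c * u x + (c * s) * e x) - (c * s) * p e"
        using 3 c by (intro le) auto
      also have "(\<lambda>x. c * u x + (c * s) * e x) = (\<lambda>x. c * (u x + s * e x))"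
        by (simp add: algebra_simps)
      also have "p \<dots> = c * p (\<lambda>x. u x + s * e x)"
        using c by (intro sublinear_scale[OF p]) simp
      finally show ?case by (simp add: algebra_simps)
    qed (use c in auto)
  next
    show "q (\<lambda>_. 0) = 0" unfolding q_def by (simp add: sublinear_scale[OF p])
  qed
  moreover have "q v \<le> p v" for v using le[of 0 v] by simp
  moreover have "q (\<lambda>x. - e x) \<le> - p e"
    using le[of 1 "\<lambda>x. - e x"] sublinear_zero[OF p] by simp
  ultimately show thesis by (rule that)
qed

text \<open>Linearity along earlier directions survives later refinements: lowering \<open>q\<close>
  can only decrease the left side of \<open>q (- e) \<le> - q e\<close> and increase the right
  side.\<close>

lemma sublinear_refine_finite:
  assumes "finite E" "sublinear p"
  shows "\<exists>q. sublinear q \<and> (\<forall>v. q v \<le> p v) \<and> (\<forall>e\<in>E. q (\<lambda>x. - e x) \<le> - q e)"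
  using assms
proof (induction E)
  case (insert e E)
  then obtain q where q: "sublinear q" "\<And>v. q v \<le> p v" "\<And>e. e \<in> E \<Longrightarrow> q (\<lambda>x. - e x) \<le> - q e"
    by blast
  obtain r where r: "sublinear r" "\<And>v. r v \<le> q v" "r (\<lambda>x. - e x) \<le> - q e"
    using sublinear_refine[OF q(1)] by blast
  have "r (\<lambda>x. - e' x) \<le> - r e'" if "e' \<in> insert e E" for e'
    using that q(3)[of e'] r(2)[of e'] r(2)[of "\<lambda>x. - e' x"] r(3) r(2)[of e] by auto
  then show ?case using r q by (meson order_trans)
qed auto

text \<open>Refining first along \<open>f\<close> retains the value there. Refining along the point
  masses \<open>\<delta> y\<close> then bounds \<open>q\<close> by the linear form with weights
  \<open>c y\<close>, and applying this to the negative of \<open>v\<close> gives the reverse bound.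
  The hypothesis \<open>supp\<close> handles the part of \<open>v\<close> outside
  \<open>X\<close>.\<close>

lemma finite_Hahn_Banach:
  fixes p :: "('a \<Rightarrow> real) \<Rightarrow> real"
  assumes "finite X" "sublinear p" and supp: "\<And>v. (\<And>x. x \<in> X \<Longrightarrow> v x = 0) \<Longrightarrow> p v \<le> 0"
  obtains c where "\<And>v. (\<Sum>x\<in>X. v x * c x) \<le> p v" "p f \<le> (\<Sum>x\<in>X. f x * c x)"
proof -
  define \<delta> where "\<delta> = (\<lambda>(y::'a) x. if x = y then 1 else 0 :: real)"
  obtain r where r: "sublinear r" "\<And>v. r v \<le> p v" "r (\<lambda>x. - f x) \<le> - p f"
    using sublinear_refine[OF assms(2)] by blast
  obtain q where q: "sublinear q" "\<And>v. q v \<le> r v" "\<And>e. e \<in> \<delta> ` X \<Longrightarrow> q (\<lambda>x. - e x) \<le> - q e"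
    using sublinear_refine_finite[OF _ r(1), of "\<delta> ` X"] assms(1) by blast
  define c where "c = (\<lambda>y. q (\<delta> y))"
  have qd: "q (\<lambda>x. t * \<delta> y x) \<le> t * c y" if "y \<in> X" for t y
  proof (cases "0 \<le> t")
    case True
    then show ?thesis by (simp add: sublinear_scale[OF q(1)] c_def)
  next
    case False
    have "q (\<lambda>x. (- t) * (- \<delta> y x)) = (- t) * q (\<lambda>x. - \<delta> y x)"
      using False by (intro sublinear_scale[OF q(1)]) simp
    also have "\<dots> \<le> (- t) * (- c y)"
      unfolding c_def using False q(3)[of "\<delta> y"] that by (intro mult_left_mono) auto
    finally show ?thesis by simp
  qed
  have part: "q (\<lambda>x. \<Sum>y\<in>Y. v y * \<delta> y x) \<le> (\<Sum>y\<in>Y. v y * c y)" if "Y \<subseteq> X" for Y v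
    using finite_subset[OF that assms(1)] that
  proof (induction Y)
    case empty
    then show ?case by (simp add: sublinear_zero[OF q(1)])
  next
    case (insert y Y)
    have "q (\<lambda>x. v y * \<delta> y x + (\<Sum>y\<in>Y. v y * \<delta> y x)) \<le> q (\<lambda>x. v y * \<delta> y x) + q (\<lambda>x. \<Sum>y\<in>Y. v y * \<delta> y x)"
      by (rule sublinear_add[OF q(1)])
    then show ?case using insert qd[of y "v y"] by simp
  qed
  have up: "q v \<le> (\<Sum>y\<in>X. v y * c y)" for v
  proof -
    define w where "w = (\<lambda>x. v x - (\<Sum>y\<in>X. v y * \<delta> y x))"
    have "w x = 0" if "x \<in> X" for x
      using that assms(1) by (simp add: w_def \<delta>_def if_distrib[of "\<lambda>c. _ * c"] cong: if_cong)
    then have "p w \<le> 0" by (rule supp)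
    then have "q w \<le> 0" using q(2)[of w] r(2)[of w] by linarith
    moreover have "q v \<le> q (\<lambda>x. \<Sum>y\<in>X. v y * \<delta> y x) + q w"
      using sublinear_add[OF q(1), of "\<lambda>x. \<Sum>y\<in>X. v y * \<delta> y x" w] by (simp add: w_def)
    ultimately show ?thesis using part[of X v] by simp
  qed
  show thesis
  proof (rule that)
    fix v
    have "(\<Sum>x\<in>X. v x * c x) \<le> - q (\<lambda>x. - v x)"
      using up[of "\<lambda>x. - v x"] by (simp add: sum_negf)
    also have "\<dots> \<le> q v" by (rule sublinear_minus[OF q(1)])
    also have "\<dots> \<le> p v" using q(2)[of v] r(2)[of v] by linarith
    finally show "(\<Sum>x\<in>X. v x * c x) \<le> p v" .
  next
    have "p f \<le> - q (\<lambda>x. - f x)" using r(3) q(2)[of "\<lambda>x. - f x"] by linarith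
    also have "\<dots> \<le> q f" by (rule sublinear_minus[OF q(1)])
    also have "\<dots> \<le> (\<Sum>x\<in>X. f x * c x)" by (rule up)
    finally show "p f \<le> (\<Sum>x\<in>X. f x * c x)" .
  qed
qed

section \<open>The dual description of the \<open>L\<^sub>1\<close> distance\<close>

lemma fourier_add: "fourier n (\<lambda>x. f x + g x) S = fourier n f S + fourier n g S"
  by (simp add: fourier_def algebra_simps sum.distrib add_divide_distrib)

lemma fourier_scale: "fourier n (\<lambda>x. c * f x) S = c * fourier n f S"
  by (simp add: fourier_def mult.assoc sum_distrib_left[symmetric])

lemma L1_norm_cube_avg: "L1_norm n f = cube_avg n (\<lambda>x. \<bar>f x\<bar>)"
  by (simp add: L1_norm_def cube_avg_def)

lemma L1_norm_nonneg: "0 \<le> L1_norm n f"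
  by (simp add: L1_norm_def sum_nonneg)

text \<open>Hahn-Banach for the distance to \<open>P_gt n k\<close>. This functional is at most the
  \<open>L\<^sub>1\<close> norm, which bounds \<open>h\<close> by 1, and it vanishes on
  \<open>P_gt n k\<close>, which kills the high coefficients of \<open>h\<close>.\<close>

lemma L1_distance_duality:
  obtains h where "\<And>x. x \<in> cube n \<Longrightarrow> \<bar>h x\<bar> \<le> 1"
    "\<And>S. S \<subseteq> {..<n} \<Longrightarrow> card S > k \<Longrightarrow> fourier n h S = 0"
    "(INF g \<in> P_gt n k. L1_norm n (\<lambda>x. f x - g x)) \<le> cube_avg n (\<lambda>x. f x * h x)"
proof -
  define p where "p = (\<lambda>v. INF g \<in> P_gt n k. L1_norm n (\<lambda>x. v x - g x))"
  have ne: "P_gt n k \<noteq> {}"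
  proof -
    have "(\<lambda>_. 0) \<in> P_gt n k" by (simp add: P_gt_def fourier_def)
    then show ?thesis by blast
  qed
  have bdd: "bdd_below ((\<lambda>g. L1_norm n (\<lambda>x. v x - g x)) ` P_gt n k)" for v
    by (rule bdd_belowI2[where m = 0]) (rule L1_norm_nonneg)
  have le: "p v \<le> L1_norm n (\<lambda>x. v x - g x)" if "g \<in> P_gt n k" for v g
    unfolding p_def using bdd that by (rule cINF_lower)
  have p0: "0 \<le> p v" for v
    unfolding p_def using ne by (intro cINF_greatest L1_norm_nonneg)
  have le0: "p v \<le> L1_norm n v" for v
    using le[of "\<lambda>_. 0" v] by (simp add: P_gt_def fourier_def)
  have sub: "sublinear p"
  proof (rule sublinearI)
    fix u v
    have "p (\<lambda>x. u x + v x) \<le> (INF g \<in> P_gt n k. L1_norm n (\<lambda>x. u x - g x)) + (INF g \<in> P_gt n k. L1_norm n (\<lambda>x. v x - g x))"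
    proof (rule le_add_INF[OF ne ne])
      fix s t assume st: "s \<in> P_gt n k" "t \<in> P_gt n k"
      have "p (\<lambda>x. u x + v x) \<le> L1_norm n (\<lambda>x. (u x + v x) - (s x + t x))"
        using st by (intro le) (auto simp: P_gt_def fourier_add)
      also have "\<dots> \<le> L1_norm n (\<lambda>x. u x - s x) + L1_norm n (\<lambda>x. v x - t x)"
        unfolding L1_norm_cube_avg cube_avg_add[symmetric] by (intro cube_avg_mono) linarith
      finally show "p (\<lambda>x. u x + v x) \<le> L1_norm n (\<lambda>x. u x - s x) + L1_norm n (\<lambda>x. v x - t x)" .
    qed
    then show "p (\<lambda>x. u x + v x) \<le> p u + p v" by (simp add: p_def)
  next
    fix c :: real and u assume c: "0 < c"
    have "p (\<lambda>x. c * u x) \<le> c * (INF g \<in> P_gt n k. L1_norm n (\<lambda>x. u x - g x))"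
    proof (rule le_mult_INF[OF ne c])
      fix s assume s: "s \<in> P_gt n k"
      have "p (\<lambda>x. c * u x) \<le> L1_norm n (\<lambda>x. c * u x - c * s x)"
        using s by (intro le) (auto simp: P_gt_def fourier_scale)
      also have "\<dots> = c * L1_norm n (\<lambda>x. u x - s x)"
        using c unfolding L1_norm_cube_avg cube_avg_cmult[symmetric]
        by (intro cube_avg_cong) (simp add: abs_mult flip: right_diff_distrib)
      finally show "p (\<lambda>x. c * u x) \<le> c * L1_norm n (\<lambda>x. u x - s x)" .
    qed
    then show "p (\<lambda>x. c * u x) \<le> c * p u" by (simp add: p_def)
  next
    show "p (\<lambda>_. 0) = 0" using le0[of "\<lambda>_. 0"] p0[of "\<lambda>_. 0"] by (simp add: L1_norm_def)
  qed
  have supp: "p v \<le> 0" if "\<And>x. x \<in> cube n \<Longrightarrow> v x = 0" for v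
    using le0[of v] that by (simp add: L1_norm_def)
  obtain c where c: "\<And>v. (\<Sum>x\<in>cube n. v x * c x) \<le> p v" "p f \<le> (\<Sum>x\<in>cube n. f x * c x)"
    using finite_Hahn_Banach[OF finite_cube sub supp] by blast
  define h where "h = (\<lambda>x. 2 ^ n * c x)"
  have avg: "cube_avg n (\<lambda>x. v x * h x) = (\<Sum>x\<in>cube n. v x * c x)" for v
    by (simp add: cube_avg_def h_def sum_divide_distrib)
  show thesis
  proof (rule that[of h])
    fix y assume y: "y \<in> cube n"
    have *: "s * c y \<le> 1 / 2 ^ n" if "\<bar>s\<bar> = 1" for s
    proof -
      \<comment> \<open>Testing against a point mass of either sign isolates the value
        \<open>c y\<close>.\<close>
      let ?v = "\<lambda>x. if x = y then s else 0"
      have "s * c y = (\<Sum>x\<in>cube n. ?v x * c x)"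
        using y by (simp add: if_distrib[of "\<lambda>c. c * _"] cong: if_cong)
      also have "\<dots> \<le> L1_norm n ?v" using c(1)[of ?v] le0[of ?v] by linarith
      also have "\<dots> = 1 / 2 ^ n" using y that by (simp add: L1_norm_def if_distrib[of abs] cong: if_cong)
      finally show ?thesis .
    qed
    have "\<bar>c y\<bar> \<le> 1 / 2 ^ n" using *[of 1] *[of "-1"] by simp
    then show "\<bar>h y\<bar> \<le> 1" by (simp add: h_def abs_mult field_simps)
  next
    fix S assume S: "S \<subseteq> {..<n}" "card S > k"
    have P: "(\<lambda>x. s * walsh S x) \<in> P_gt n k" for s
      using S by (auto simp: P_gt_def fourier_scale fourier_walsh)
    \<comment> \<open>Every multiple of \<open>walsh S\<close> has distance 0; using both signs of
      \<open>s\<close> then gives orthogonality.\<close>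
    have *: "cube_avg n (\<lambda>x. s * walsh S x * h x) \<le> 0" for s
      using c(1)[of "\<lambda>x. s * walsh S x"] le[OF P[of s], of "\<lambda>x. s * walsh S x"]
      unfolding avg by (simp add: L1_norm_def)
    have "fourier n h S = cube_avg n (\<lambda>x. walsh S x * h x)"
      by (simp add: fourier_cube_avg mult.commute)
    then show "fourier n h S = 0"
      using *[of 1] *[of "-1"] cube_avg_cmult[of n "-1" "\<lambda>x. walsh S x * h x"] by simp
  next
    show "(INF g \<in> P_gt n k. L1_norm n (\<lambda>x. f x - g x)) \<le> cube_avg n (\<lambda>x. f x * h x)"
      using c(2) unfolding avg p_def .
  qed
qed

subsection \<open>The K-functional bound\<close>

text \<open>Hoelder's inequality from Young's, term by term after normalising \<open>u\<close> and
  \<open>v\<close>. As \<open>M \<ge> 1\<close>, both resulting sums may be bounded by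
  \<open>M\<close>, and the weights \<open>1 / p\<close> and \<open>1 / q\<close> add up to
  1.\<close>

lemma sum_mult_le_lp_norm:
  fixes u v :: "'i \<Rightarrow> real"
  assumes "finite I" "p > 1" "q > 1" "1 / p + 1 / q = 1" "A > 0"
    and "(\<Sum>i\<in>I. (\<bar>v i\<bar> / A) powr p) \<le> M" "M \<ge> 1"
  shows "(\<Sum>i\<in>I. u i * v i) \<le> M * A * lp_norm I q u"
proof -
  define U where "U = lp_norm I q u"
  have U0: "0 \<le> U" by (simp add: U_def lp_norm_def)
  have Uq: "U powr q = (\<Sum>i\<in>I. \<bar>u i\<bar> powr q)"
    using assms(3) by (simp add: U_def lp_norm_def powr_powr sum_nonneg)
  show ?thesis
  proof (cases "U = 0")
    case True
    then have "(\<Sum>i\<in>I. \<bar>u i\<bar> powr q) = 0" using Uq by simp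
    then have "u i = 0" if "i \<in> I" for i using that assms(1) by (simp add: sum_nonneg_eq_0_iff)
    then show ?thesis using True by (simp add: U_def[symmetric])
  next
    case False
    have "(\<Sum>i\<in>I. \<bar>u i\<bar> / U * (\<bar>v i\<bar> / A)) \<le>
        (\<Sum>i\<in>I. (\<bar>v i\<bar> / A) powr p / p + (\<bar>u i\<bar> / U) powr q / q)"
      using assms U0
      by (intro sum_mono) (subst mult.commute, intro Youngs_inequality, auto)
    also have "\<dots> = (\<Sum>i\<in>I. (\<bar>v i\<bar> / A) powr p) / p + (\<Sum>i\<in>I. (\<bar>u i\<bar> / U) powr q) / q"
      by (simp add: sum.distrib sum_divide_distrib)
    also have "(\<Sum>i\<in>I. (\<bar>u i\<bar> / U) powr q) = 1"
      using U0 False by (simp add: powr_divide Uq[symmetric] flip: sum_divide_distrib)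
    also have "(\<Sum>i\<in>I. (\<bar>v i\<bar> / A) powr p) / p + 1 / q \<le> M / p + M / q"
      using assms by (intro add_mono divide_right_mono) auto
    also have "\<dots> = M * (1 / p + 1 / q)" by (simp add: algebra_simps)
    finally have "(\<Sum>i\<in>I. \<bar>u i\<bar> / U * (\<bar>v i\<bar> / A)) \<le> M" using assms(4) by simp
    moreover have "(\<Sum>i\<in>I. \<bar>u i\<bar> / U * (\<bar>v i\<bar> / A)) = (\<Sum>i\<in>I. \<bar>u i\<bar> * \<bar>v i\<bar>) / (U * A)"
      by (simp add: sum_divide_distrib)
    ultimately have "(\<Sum>i\<in>I. \<bar>u i\<bar> * \<bar>v i\<bar>) \<le> M * (U * A)"
      using U0 False assms(5) by (simp add: divide_le_eq)
    moreover have "(\<Sum>i\<in>I. u i * v i) \<le> (\<Sum>i\<in>I. \<bar>u i\<bar> * \<bar>v i\<bar>)"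
      by (intro sum_mono) (metis abs_ge_self abs_mult)
    ultimately show ?thesis by (simp add: U_def mult_ac)
  qed
qed

text \<open>The exponents \<open>2 * d / (d + 1)\<close> and \<open>2 * d / (d - 1)\<close> are
  conjugate; for \<open>d = 1\<close> they degenerate to 1 and infinity, a case treated
  directly.\<close>

lemma sum_mult_le_ell_d_norm:
  fixes u v :: "'i \<Rightarrow> real"
  assumes "finite I" "I \<noteq> {}" "d \<ge> 1" "A > 0"
    and v: "(\<Sum>i\<in>I. (\<bar>v i\<bar> / A) powr (2 * real d / (real d + 1))) \<le> M" "M \<ge> 1"
  shows "(\<Sum>i\<in>I. u i * v i) \<le> M * A * ell_d_norm d I u"
proof (cases "d = 1")
  case True
  have "(\<Sum>i\<in>I. u i * v i) \<le> (\<Sum>i\<in>I. linf_norm I u * \<bar>v i\<bar>)"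
  proof (rule sum_mono)
    fix i assume "i \<in> I"
    then have "\<bar>u i\<bar> \<le> linf_norm I u" using assms(1) by (simp add: linf_norm_def)
    then have "\<bar>u i\<bar> * \<bar>v i\<bar> \<le> linf_norm I u * \<bar>v i\<bar>" by (rule mult_right_mono) simp
    then show "u i * v i \<le> linf_norm I u * \<bar>v i\<bar>" by (metis abs_ge_self abs_mult order_trans)
  qed
  also have "\<dots> = linf_norm I u * (\<Sum>i\<in>I. \<bar>v i\<bar>)" by (simp add: sum_distrib_left)
  also have "\<dots> \<le> linf_norm I u * (M * A)"
  proof (rule mult_left_mono)
    have "(\<Sum>i\<in>I. \<bar>v i\<bar> / A) \<le> M" using v(1) True assms(4) by simp
    then show "(\<Sum>i\<in>I. \<bar>v i\<bar>) \<le> M * A" using assms(4) by (simp add: divide_le_eq flip: sum_divide_distrib)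
    obtain i where "i \<in> I" using assms(2) by blast
    then have "\<bar>u i\<bar> \<le> linf_norm I u" using assms(1) by (simp add: linf_norm_def)
    then show "0 \<le> linf_norm I u" by linarith
  qed
  finally show ?thesis using True by (simp add: ell_d_norm_def mult_ac)
next
  case False
  then have d: "real d > 1" using assms(3) by simp
  have "1 / (2 * real d / (real d + 1)) + 1 / (2 * real d / (real d - 1)) = 1"
    using d by (simp add: field_simps)
  then show ?thesis
    using sum_mult_le_lp_norm[OF assms(1) _ _ _ assms(4) v, of "2 * real d / (real d - 1)" u] d False
    by (simp add: ell_d_norm_def less_divide_eq)
qed

lemma sum_mult_le_l2_norm:
  fixes u v :: "'i \<Rightarrow> real"
  assumes "(\<Sum>i\<in>I. (v i)\<^sup>2) \<le> 1"
  shows "(\<Sum>i\<in>I. u i * v i) \<le> lp_norm I 2 u"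
proof -
  have "(\<Sum>i\<in>I. u i * v i)\<^sup>2 \<le> (\<Sum>i\<in>I. (u i)\<^sup>2) * (\<Sum>i\<in>I. (v i)\<^sup>2)"
    by (rule Cauchy_Schwarz_ineq_sum)
  also have "\<dots> \<le> (\<Sum>i\<in>I. (u i)\<^sup>2)"
    using assms by (intro mult_left_le) (auto intro: sum_nonneg)
  finally have "\<bar>\<Sum>i\<in>I. u i * v i\<bar> \<le> sqrt (\<Sum>i\<in>I. (u i)\<^sup>2)"
    by (metis real_sqrt_abs real_sqrt_le_mono)
  also have "\<dots> = lp_norm I 2 u"
  proof -
    have "\<bar>u i\<bar> powr 2 = (u i)\<^sup>2" for i by (cases "u i = 0") (auto simp: powr_numeral)
    then show ?thesis by (simp add: lp_norm_def powr_half_sqrt sum_nonneg)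
  qed
  finally show ?thesis by linarith
qed

theorem theorem1p3:
  fixes d :: nat
  assumes "d \<ge> 1"
  shows "\<exists>C::real. C > 0 \<and>
    (\<forall>n k f. d \<le> k \<longrightarrow> k \<le> n \<longrightarrow> degree_le n d f \<longrightarrow>
       (INF g \<in> P_gt n k. L1_norm n (\<lambda>x. f x - g x))
         \<le> K_functional (lp_norm (low_sets n d) 2) (ell_d_norm d (low_sets n d))
              (fourier n f) (C * real k ^ d))"
proof -
  \<comment> \<open>The factor \<open>6 * 6 ^ d * d\<close> comes from summing the influences,
    \<open>d + 1\<close> from bounding the low-degree part; the 4 in the final constant is the bound
    on the sum of powers.\<close>
  define A0 where "A0 = 6 * 6 ^ d * real d * (real d + 1)"
  have A0: "A0 \<ge> 1"
    unfolding A0_def using assms by (intro mult_ge1_I) auto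
  have "(INF g \<in> P_gt n k. L1_norm n (\<lambda>x. f x - g x))
         \<le> K_functional (lp_norm (low_sets n d) 2) (ell_d_norm d (low_sets n d))
              (fourier n f) (4 * A0 * real k ^ d)"
    if dk: "d \<le> k" and deg: "degree_le n d f" for n k f
  proof -
    obtain h where h: "\<And>x. x \<in> cube n \<Longrightarrow> \<bar>h x\<bar> \<le> 1"
      "\<And>S. S \<subseteq> {..<n} \<Longrightarrow> card S > k \<Longrightarrow> fourier n h S = 0"
      "(INF g \<in> P_gt n k. L1_norm n (\<lambda>x. f x - g x)) \<le> cube_avg n (\<lambda>x. f x * h x)"
      using L1_distance_duality[of n k f] by blast
    define a where "a = fourier n h"
    \<comment> \<open>The coefficients of the low-degree part of \<open>h\<close>; they agree with
      \<open>a\<close> on the index set \<open>low_sets n d\<close>.\<close>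
    define b where "b = (\<lambda>S. if card S \<le> d then a S else 0)"
    define A where "A = A0 * real k ^ d"
    have k1: "1 \<le> k" using dk assms by simp
    have A1: "1 \<le> A" unfolding A_def using A0 k1 by (intro mult_ge1_I) auto
    have ha: "walsh_sum n a x = h x" if "x \<in> cube n" for x
      unfolding a_def using that by (rule fourier_inversion)
    have a2: "(\<Sum>S\<in>Pow {..<n}. (a S)\<^sup>2) \<le> 1"
    proof -
      have "cube_avg n (\<lambda>x. (walsh_sum n a x)\<^sup>2) \<le> cube_avg n (\<lambda>_. 1)"
        using h(1) by (intro cube_avg_mono) (simp add: ha abs_square_le_1)
      then show ?thesis by (simp add: parseval_square)
    qed
    have bA: "\<bar>b S\<bar> \<le> A" if "S \<subseteq> {..<n}" for S
    proof -
      have "(a S)\<^sup>2 \<le> (\<Sum>S\<in>Pow {..<n}. (a S)\<^sup>2)" using that by (intro member_le_sum) auto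
      then have "\<bar>a S\<bar> \<le> 1" using a2 by (simp add: abs_square_le_1[symmetric])
      then show ?thesis using A1 by (simp add: b_def)
    qed
    have b0: "b S = 0" if "S \<subseteq> {..<n}" "card S > d" for S
      using that by (simp add: b_def)
    have bB: "\<bar>walsh_sum n b x\<bar> \<le> (real d + 1) * real k ^ d" if "x \<in> cube n" for x
      using low_degree_part_bounded[of n k a 1 x d] h(1,2) ha that k1 by (simp add: b_def a_def)
    have "(\<Sum>i<n. sqrt (\<Sum>S\<in>Pow {..<n}. if i \<in> S then (b S)\<^sup>2 else 0)) \<le> A"
      using sum_influences_le[of n d b, OF b0 bB] by (simp add: A_def A0_def mult_ac)
    then have bh: "(\<Sum>S\<in>Pow {..<n}. (\<bar>b S\<bar> / A) powr (2 * real d / (real d + 1))) \<le> 4"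
      using sum_powr_le_of_influences[of n d b A] b0 bA A1 by simp
    let ?I = "low_sets n d"
    have I: "finite ?I" "?I \<subseteq> Pow {..<n}" "{} \<in> ?I"
      by (auto simp: low_sets_def intro: finite_subset[of _ "Pow {..<n}"])
    have "(\<Sum>S\<in>?I. (\<bar>a S\<bar> / A) powr (2 * real d / (real d + 1))) =
        (\<Sum>S\<in>?I. (\<bar>b S\<bar> / A) powr (2 * real d / (real d + 1)))"
      by (intro sum.cong) (auto simp: b_def low_sets_def)
    also have "\<dots> \<le> (\<Sum>S\<in>Pow {..<n}. (\<bar>b S\<bar> / A) powr (2 * real d / (real d + 1)))"
      using I by (intro sum_mono2) auto
    finally have aI: "(\<Sum>S\<in>?I. (\<bar>a S\<bar> / A) powr (2 * real d / (real d + 1))) \<le> 4"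
      using bh by linarith
    have "(\<Sum>S\<in>?I. (a S)\<^sup>2) \<le> (\<Sum>S\<in>Pow {..<n}. (a S)\<^sup>2)"
      using I by (intro sum_mono2) auto
    then have aI2: "(\<Sum>S\<in>?I. (a S)\<^sup>2) \<le> 1" using a2 by linarith
    \<comment> \<open>As \<open>f\<close> has degree at most \<open>d\<close>, Parseval reduces its
      pairing with \<open>h\<close> to the index set of the K-functional.\<close>
    have "cube_avg n (\<lambda>x. f x * h x) = cube_avg n (\<lambda>x. walsh_sum n (fourier n f) x * walsh_sum n a x)"
      by (intro cube_avg_cong) (simp add: ha fourier_inversion)
    also have "\<dots> = (\<Sum>S\<in>Pow {..<n}. fourier n f S * a S)" by (rule parseval)
    also have "\<dots> = (\<Sum>S\<in>?I. fourier n f S * a S)"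
      using deg by (intro sum.mono_neutral_right) (auto simp: low_sets_def degree_le_def)
    finally have pair: "cube_avg n (\<lambda>x. f x * h x) = (\<Sum>S\<in>?I. fourier n f S * a S)" .
    show ?thesis
      unfolding K_functional_def
    proof (rule cINF_greatest)
      fix a0 :: "nat set \<Rightarrow> real"
      \<comment> \<open>For an arbitrary decomposition, \<open>a0\<close> is paired with
        \<open>a\<close> by Cauchy-Schwarz and the remainder by Hoelder.\<close>
      have "(\<Sum>S\<in>?I. fourier n f S * a S) =
          (\<Sum>S\<in>?I. a0 S * a S) + (\<Sum>S\<in>?I. (fourier n f S - a0 S) * a S)"
        by (simp add: algebra_simps flip: sum.distrib)
      also have "\<dots> \<le> lp_norm ?I 2 a0 + 4 * A * ell_d_norm d ?I (\<lambda>S. fourier n f S - a0 S)"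
        using I A1 aI assms
        by (intro add_mono sum_mult_le_l2_norm aI2 sum_mult_le_ell_d_norm) auto
      finally show "(INF g \<in> P_gt n k. L1_norm n (\<lambda>x. f x - g x)) \<le>
          lp_norm ?I 2 a0 + 4 * A0 * real k ^ d * ell_d_norm d ?I (\<lambda>S. fourier n f S - a0 S)"
        using h(3) pair by (simp add: A_def mult.assoc)
    qed simp
  qed
  then show ?thesis using A0 by (intro exI[of _ "4 * A0"]) auto
qed

end
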